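(* Let $B$ be a continuous linear operator on $H(\mathbb{C})$ and let $n\ge 0$ be an integer such that $B=T_nBT_n$. Suppose also that for every $j\ge 0$ the sequence $(B^m z^j)_m$ converges to $0$ in $H(\mathbb{C})$ as $m\to+\infty$. Then for every $\delta\in(0,1)$, the operator $A=B+\delta S_{n+1}$ supports a hypercyclic algebra.
   Context: $H(\mathbb{C})$ is the algebra (with pointwise product) of entire functions on $\mathbb{C}$, endowed with the topology of uniform convergence on compact sets; $z^j$ denotes the monomial function of degree $j$. For $n\ge 0$, $T_n:H(\mathbb{C})\to H(\mathbb{C})$ is the Taylor truncation operator $T_nf(z)=\sum_{j=0}^n\frac{f^{(j)}(0)}{j!}z^j$. For $n\ge 1$, $S_n=\frac1{n!}D^n$, where $D:f\mapsto f'$ is the differentiation operator. A vector $x$ is hypercyclic for a continuous operator $T$ on $X$ if $\{T^n x: n\ge 0\}$ is dense in $X$; $\mathrm{HC}(T)$ is the set of hypercyclic vectors for $T$. $T$ supports (admits) a hypercyclic algebra if $\mathrm{HC}(T)\cup\{0\}$ contains a non-trivial (i.e. $\neq\{0\}$) subalgebra of $X$. *)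

theory Defs
  imports "HOL-Analysis.Analysis"
begin

definition entire_functions :: "(complex \<Rightarrow> complex) set" where
  "entire_functions = {f. f holomorphic_on UNIV}"

definition compact_nhd :: "(complex \<Rightarrow> complex) \<Rightarrow> complex set \<Rightarrow> real \<Rightarrow> (complex \<Rightarrow> complex) set" where
  "compact_nhd f K e = {g \<in> entire_functions. \<forall>z\<in>K. dist (g z) (f z) < e}"

(* The space H(C): the topology of uniform convergence on compact sets, with carrier the
   entire functions.  Convergence in it is characterised in limitin_entire_topology below. *)
definition entire_topology :: "(complex \<Rightarrow> complex) topology" where
  "entire_topology = topology (\<lambda>U. U \<subseteq> entire_functions \<and>
     (\<forall>f\<in>U. \<exists>K e. compact K \<and> 0 < e \<and> compact_nhd f K e \<subseteq> U))"

lemma openin_entire_topology: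
  "openin entire_topology U \<longleftrightarrow> U \<subseteq> entire_functions \<and>
     (\<forall>f\<in>U. \<exists>K e. compact K \<and> 0 < e \<and> compact_nhd f K e \<subseteq> U)"
proof -
  let ?P = "\<lambda>U f. \<exists>K e. compact K \<and> 0 < e \<and> compact_nhd f K e \<subseteq> U"
  have int: "?P (S \<inter> T) f" if S: "?P S f" and T: "?P T f" for S T f
  proof -
    from S obtain K d where K: "compact K" "0 < d" "compact_nhd f K d \<subseteq> S" by blast
    from T obtain L e where L: "compact L" "0 < e" "compact_nhd f L e \<subseteq> T" by blast
    have "compact_nhd f (K \<union> L) (min d e) \<subseteq> compact_nhd f K d \<inter> compact_nhd f L e"
      by (auto simp: compact_nhd_def)
    with K L have "compact (K \<union> L) \<and> 0 < min d e \<and> compact_nhd f (K \<union> L) (min d e) \<subseteq> S \<inter> T"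
      by auto
    then show ?thesis by blast
  qed
  have "istopology (\<lambda>U. U \<subseteq> entire_functions \<and> (\<forall>f\<in>U. ?P U f))"
    unfolding istopology_def
  proof (rule conjI; intro allI impI)
    fix S T assume S: "S \<subseteq> entire_functions \<and> (\<forall>f\<in>S. ?P S f)"
      and T: "T \<subseteq> entire_functions \<and> (\<forall>f\<in>T. ?P T f)"
    have "?P (S \<inter> T) f" if "f \<in> S \<inter> T" for f
      by (rule int) (use S T that in simp_all)
    then show "S \<inter> T \<subseteq> entire_functions \<and> (\<forall>f\<in>S \<inter> T. ?P (S \<inter> T) f)"
      using S by auto
  next
    fix \<K> assume A: "\<forall>U\<in>\<K>. U \<subseteq> entire_functions \<and> (\<forall>f\<in>U. ?P U f)"
    have "?P (\<Union>\<K>) f" if "f \<in> \<Union>\<K>" for f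
    proof -
      from that obtain S where S: "S \<in> \<K>" "f \<in> S" by (rule UnionE)
      with A have "?P S f" by simp
      then obtain K e where "compact K" "0 < e" "compact_nhd f K e \<subseteq> S" by (elim exE conjE)
      moreover have "S \<subseteq> \<Union>\<K>" using S(1) by (rule Union_upper)
      ultimately show ?thesis by (meson order_trans)
    qed
    moreover have "\<Union>\<K> \<subseteq> entire_functions" using A by (simp add: Union_least)
    ultimately show "\<Union>\<K> \<subseteq> entire_functions \<and> (\<forall>f\<in>\<Union>\<K>. ?P (\<Union>\<K>) f)"
      by simp
  qed
  then show ?thesis
    by (simp add: entire_topology_def topology_inverse')
qed

lemma topspace_entire_topology: "topspace entire_topology = entire_functions"
proof
  show "topspace entire_topology \<subseteq> entire_functions"
    using openin_topspace[of entire_topology] by (simp only: openin_entire_topology)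
  have "openin entire_topology entire_functions"
    unfolding openin_entire_topology
  proof (intro conjI ballI exI)
    show "compact ({} :: complex set)" "0 < (1::real)" by simp_all
    show "compact_nhd f {} 1 \<subseteq> entire_functions" for f
      unfolding compact_nhd_def by (rule Collect_restrict)
  qed (rule subset_refl)
  then show "entire_functions \<subseteq> topspace entire_topology"
    by (rule openin_subset)
qed

lemma openin_compact_nhd:
  assumes "f \<in> entire_functions" "compact K"
  shows "openin entire_topology (compact_nhd f K e)"
  unfolding openin_entire_topology
proof (intro conjI ballI)
  show "compact_nhd f K e \<subseteq> entire_functions" by (auto simp: compact_nhd_def)
  fix g assume g: "g \<in> compact_nhd f K e"
  have cont: "continuous_on K (\<lambda>z. dist (g z) (f z))"
  proof (rule continuous_on_dist)
    have "g holomorphic_on UNIV" "f holomorphic_on UNIV"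
      using g assms(1) by (simp_all add: compact_nhd_def entire_functions_def)
    then show "continuous_on K g" "continuous_on K f"
      using holomorphic_on_imp_continuous_on continuous_on_subset[OF _ subset_UNIV] by blast+
  qed
  obtain d where d: "0 < d" "\<forall>z\<in>K. dist (g z) (f z) + d \<le> e"
  proof (cases "K = {}")
    case True
    then show ?thesis using that[of 1] by simp
  next
    case False
    obtain w where w: "w \<in> K" "\<forall>z\<in>K. dist (g z) (f z) \<le> dist (g w) (f w)"
      using continuous_attains_sup[OF assms(2) False cont] by blast
    with g have "dist (g w) (f w) < e" by (auto simp: compact_nhd_def)
    with w show ?thesis by (intro that[of "e - dist (g w) (f w)"]) auto
  qed
  have "compact_nhd g K d \<subseteq> compact_nhd f K e"
  proof
    fix h assume h: "h \<in> compact_nhd g K d"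
    have "dist (h z) (f z) < e" if "z \<in> K" for z
    proof -
      have "dist (h z) (g z) < d" using h that by (auto simp: compact_nhd_def)
      moreover have "dist (g z) (f z) + d \<le> e" using d that by blast
      ultimately show ?thesis using dist_triangle[of "h z" "f z" "g z"] by linarith
    qed
    with h show "h \<in> compact_nhd f K e" by (auto simp: compact_nhd_def)
  qed
  with assms(2) d show "\<exists>L d. compact L \<and> 0 < d \<and> compact_nhd g L d \<subseteq> compact_nhd f K e" by blast
qed

lemma limitin_entire_topology:
  assumes f: "\<And>m. f m \<in> entire_functions"
  shows "limitin entire_topology f l F \<longleftrightarrow>
    l \<in> entire_functions \<and> (\<forall>K. compact K \<longrightarrow> uniform_limit K f l F)"
proof (intro iffI conjI allI impI)
  assume L: "limitin entire_topology f l F"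
  then show l: "l \<in> entire_functions"
    by (metis limitin_topspace topspace_entire_topology)
  fix K :: "complex set" assume K: "compact K"
  show "uniform_limit K f l F"
    unfolding uniform_limit_iff
  proof (intro allI impI)
    fix e :: real assume "0 < e"
    then have "l \<in> compact_nhd l K e" using l by (auto simp: compact_nhd_def)
    from limitinD[OF L openin_compact_nhd[OF l K] this]
    show "\<forall>\<^sub>F n in F. \<forall>x\<in>K. dist (f n x) (l x) < e"
      by (rule eventually_mono) (auto simp: compact_nhd_def)
  qed
next
  assume A: "l \<in> entire_functions \<and> (\<forall>K. compact K \<longrightarrow> uniform_limit K f l F)"
  show "limitin entire_topology f l F"
    unfolding limitin_def topspace_entire_topology
  proof (intro conjI allI impI)
    show "l \<in> entire_functions" using A by blast
    fix U assume "openin entire_topology U \<and> l \<in> U"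
    then have "\<exists>K e. compact K \<and> 0 < e \<and> compact_nhd l K e \<subseteq> U"
      by (simp add: openin_entire_topology)
    then obtain K e where K: "compact K" "0 < e" "compact_nhd l K e \<subseteq> U"
      by (elim exE conjE)
    then have "\<forall>\<^sub>F n in F. \<forall>x\<in>K. dist (f n x) (l x) < e"
      using A by (simp add: uniform_limit_iff)
    then show "\<forall>\<^sub>F n in F. f n \<in> U"
    proof (rule eventually_mono)
      fix n assume "\<forall>x\<in>K. dist (f n x) (l x) < e"
      then have "f n \<in> compact_nhd l K e" using f[of n] by (simp add: compact_nhd_def)
      then show "f n \<in> U" using K(3) by (rule subsetD[rotated])
    qed
  qed
qed

(* Operators on H(C) are HOL functions on all of complex => complex; only their values on
   entire functions matter. *)
definition continuous_linear_operator ::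
  "((complex \<Rightarrow> complex) \<Rightarrow> (complex \<Rightarrow> complex)) \<Rightarrow> bool" where
  "continuous_linear_operator T \<longleftrightarrow>
     continuous_map entire_topology entire_topology T \<and>
     (\<forall>f\<in>entire_functions. \<forall>g\<in>entire_functions. T (\<lambda>z. f z + g z) = (\<lambda>z. T f z + T g z)) \<and>
     (\<forall>c. \<forall>f\<in>entire_functions. T (\<lambda>z. c * f z) = (\<lambda>z. c * T f z))"

definition taylor_truncation :: "nat \<Rightarrow> (complex \<Rightarrow> complex) \<Rightarrow> (complex \<Rightarrow> complex)" where
  "taylor_truncation n f = (\<lambda>z. \<Sum>j\<le>n. (deriv ^^ j) f 0 / fact j * z ^ j)"

definition scaled_deriv :: "nat \<Rightarrow> (complex \<Rightarrow> complex) \<Rightarrow> (complex \<Rightarrow> complex)" where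
  "scaled_deriv n f = (\<lambda>z. 1 / fact n * (deriv ^^ n) f z)"

definition hypercyclic_vectors :: "'a topology \<Rightarrow> ('a \<Rightarrow> 'a) \<Rightarrow> 'a set" where
  "hypercyclic_vectors X T =
     {x \<in> topspace X. X closure_of {(T ^^ n) x | n. True} = topspace X}"

(* Subalgebras of H(C) are complex subspaces closed under the pointwise product; they need not
   contain the constant function 1. *)
definition is_subalgebra :: "(complex \<Rightarrow> complex) set \<Rightarrow> bool" where
  "is_subalgebra M \<longleftrightarrow>
     M \<subseteq> entire_functions \<and>
     (\<lambda>z. 0) \<in> M \<and>
     (\<forall>f\<in>M. \<forall>g\<in>M. (\<lambda>z. f z + g z) \<in> M) \<and>
     (\<forall>c. \<forall>f\<in>M. (\<lambda>z. c * f z) \<in> M) \<and>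
     (\<forall>f\<in>M. \<forall>g\<in>M. (\<lambda>z. f z * g z) \<in> M)"

definition supports_hypercyclic_algebra ::
  "((complex \<Rightarrow> complex) \<Rightarrow> (complex \<Rightarrow> complex)) \<Rightarrow> bool" where
  "supports_hypercyclic_algebra T \<longleftrightarrow>
     (\<exists>M. is_subalgebra M \<and> M \<noteq> {\<lambda>z. 0} \<and>
          M \<subseteq> hypercyclic_vectors entire_topology T \<union> {\<lambda>z. 0})"

end

theory Submission
  imports Defs "HOL-Complex_Analysis.Complex_Analysis"
begin

text \<open>
  Put \<open>N = n + 1\<close> and \<open>c = \<delta> / N!\<close>. The operator \<open>A = B + \<delta> S\<^sub>N\<close> lowers the exponent of
  \<open>z\<^sup>k\<close>, \<open>k \<ge> N\<close>, by \<open>N\<close> at the cost of a factor \<open>c * k! / (k - N)!\<close>, because \<open>B\<close> kills these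
  monomials; on polynomials of degree at most \<open>n\<close> it coincides with \<open>B\<close>, whose iterates tend to zero.
  Hence every orbit of a polynomial under \<open>A\<close> tends to zero.

  It suffices to find, for any \<open>m \<ge> 1\<close>, an entire \<open>u\<close> near a given function and a number \<open>q\<close> such that
  \<open>A\<^sup>q\<close> sends \<open>u\<^sup>m\<close> near a given target and \<open>u, \<dots>, u\<^bsup>m - 1\<^esup>\<close> near zero. A Baire category
  argument then yields one \<open>u\<close> with this property for all data, and in the algebra it generates the
  leading term of each polynomial in \<open>u\<close> decides (\<open>hypercyclic_algebra_criterion\<close>).

  To construct \<open>u\<close>, approximate the given function by a polynomial \<open>p\<close> and add a perturbation
  \<open>\<epsilon> z\<^sup>K b (z / L)\<close> with \<open>K = N \<kappa>\<close>, \<open>q = m \<kappa>\<close> and \<open>L = m K = N q\<close>, where \<open>\<epsilon>\<^sup>m c\<^sup>q L! = 1\<close>. As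
  \<open>\<kappa>\<close> grows, the following happens.

    \<^item> The perturbation tends to zero locally uniformly (\<open>bump_limit\<close>).

    \<^item> In the expansion of a power of \<open>u\<close>, a term with \<open>l\<close> factors of the perturbation, \<open>0 < l < m\<close>, is
      mapped by \<open>A\<^sup>q\<close> to something of size about \<open>\<epsilon>\<^sup>l c\<^bsup>\<kappa> l\<^esup> (K l)!\<close>, which is
      \<open>(K l)! / ((K m)!)\<^bsup>l / m\<^esup>\<close>. Strict log-convexity of the factorial makes this decay like
      \<open>(l / m)\<^bsup>K l\<^esup>\<close>, faster than the polynomial corrections grow
      (\<open>scaled_monomial_coefficient_tendsto\<close>, \<open>lower_power_limit\<close>).

    \<^item> The \<open>m\<close>-th power of the perturbation is mapped to
      \<open>\<Sum>j. b\<^sub>j (L + j)! / (L! L\<^sup>j j!) z\<^sup>j\<close>, with \<open>b\<^sub>j\<close> the coefficients of \<open>b\<^sup>m\<close>. This tends to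
      the Borel transform \<open>\<Sum>j. b\<^sub>j / j! z\<^sup>j\<close> (\<open>top_power_limit\<close>).

  So the targets that can be reached are the Borel transforms of \<open>m\<close>-th powers of polynomials. They are
  dense: a polynomial with nonzero constant term has a holomorphic \<open>m\<close>-th root near the origin, and
  approximation near the origin is enough, since the Borel transform spreads it to all compact sets
  (\<open>borel_transforms_of_powers_dense\<close>).
\<close>

section \<open>The space of entire functions and its operators\<close>

lemma small_factor:
  fixes c e :: real
  assumes "0 < e" "0 \<le> c"
  obtains d where "0 < d" "c * d \<le> e / 2" "d \<le> e / 2"
proof (rule that[of "e / (2 * (c + 1))"])
  have "c * e \<le> (c + 1) * e" "e \<le> (c + 1) * e" using assms by (auto simp: algebra_simps)
  then show "c * (e / (2 * (c + 1))) \<le> e / 2" "e / (2 * (c + 1)) \<le> e / 2"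
    using assms by (auto simp: divide_simps)
qed (use assms in auto)

lemma entire_const: "(\<lambda>z. c) \<in> entire_functions"
  and entire_monomial: "(\<lambda>z. z ^ k) \<in> entire_functions"
  and entire_poly: "poly p \<in> entire_functions"
  by (auto simp: entire_functions_def intro!: holomorphic_intros)

lemma entire_add: "f \<in> entire_functions \<Longrightarrow> g \<in> entire_functions \<Longrightarrow> (\<lambda>z. f z + g z) \<in> entire_functions"
  and entire_diff: "f \<in> entire_functions \<Longrightarrow> g \<in> entire_functions \<Longrightarrow> (\<lambda>z. f z - g z) \<in> entire_functions"
  and entire_mult: "f \<in> entire_functions \<Longrightarrow> g \<in> entire_functions \<Longrightarrow> (\<lambda>z. f z * g z) \<in> entire_functions"
  and entire_power: "f \<in> entire_functions \<Longrightarrow> (\<lambda>z. f z ^ k) \<in> entire_functions"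
  by (auto simp: entire_functions_def intro!: holomorphic_intros)

lemma entire_sum:
  assumes "\<And>i. i \<in> I \<Longrightarrow> f i \<in> entire_functions"
  shows "(\<lambda>z. \<Sum>i\<in>I. f i z) \<in> entire_functions"
  using assms by (auto simp: entire_functions_def intro!: holomorphic_intros)

lemma entire_poly_compose: "f \<in> entire_functions \<Longrightarrow> (\<lambda>z. poly p (f z)) \<in> entire_functions"
  unfolding poly_altdef by (intro entire_sum entire_mult entire_const entire_power)

lemma entire_higher_deriv: "f \<in> entire_functions \<Longrightarrow> (deriv ^^ k) f \<in> entire_functions"
  by (auto simp: entire_functions_def intro: holomorphic_higher_deriv)

lemma entire_continuous_on: "f \<in> entire_functions \<Longrightarrow> continuous_on S f"
  unfolding entire_functions_def
  using continuous_on_subset holomorphic_on_imp_continuous_on by blast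

lemma compact_nhd_mono: "K \<subseteq> L \<Longrightarrow> e \<le> d \<Longrightarrow> compact_nhd f L e \<subseteq> compact_nhd f K d"
  by (fastforce simp: compact_nhd_def)

text \<open>Discs centred at the origin exhaust the plane, so continuity need only be tested on them; the maps
  may be nonlinear, which the power maps below require.\<close>

lemma continuous_map_entire_topologyI:
  assumes maps: "\<And>f. f \<in> entire_functions \<Longrightarrow> T f \<in> entire_functions"
    and nhd: "\<And>f r e. f \<in> entire_functions \<Longrightarrow> 0 < e \<Longrightarrow>
      \<exists>K d. compact K \<and> 0 < d \<and>
        (\<forall>g\<in>compact_nhd f K d. \<forall>z\<in>cball 0 r. dist (T g z) (T f z) < e)"
  shows "continuous_map entire_topology entire_topology T"
  unfolding continuous_map_def topspace_entire_topology
proof (intro conjI allI impI)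
  show "T \<in> entire_functions \<rightarrow> entire_functions" using maps by auto
  fix U assume "openin entire_topology U"
  then have U: "U \<subseteq> entire_functions"
    "\<And>f. f \<in> U \<Longrightarrow> \<exists>K e. compact K \<and> 0 < e \<and> compact_nhd f K e \<subseteq> U"
    by (auto simp: openin_entire_topology)
  show "openin entire_topology {f \<in> entire_functions. T f \<in> U}"
    unfolding openin_entire_topology
  proof (intro conjI ballI)
    fix f assume f: "f \<in> {f \<in> entire_functions. T f \<in> U}"
    then obtain K e where K: "compact K" "0 < e" "compact_nhd (T f) K e \<subseteq> U" using U(2) by blast
    obtain r where r: "K \<subseteq> cball 0 r"
      using bounded_subset_ballD[OF compact_imp_bounded[OF K(1)], of 0] ball_subset_cball by blast
    obtain L d where L: "compact L" "0 < d"
      "\<forall>g\<in>compact_nhd f L d. \<forall>z\<in>cball 0 r. dist (T g z) (T f z) < e"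
      using nhd[of f e r] f K(2) by blast
    have "compact_nhd f L d \<subseteq> {f \<in> entire_functions. T f \<in> U}"
    proof
      fix g assume g: "g \<in> compact_nhd f L d"
      then have "g \<in> entire_functions" by (simp add: compact_nhd_def)
      moreover have "T g \<in> compact_nhd (T f) K e"
        using L(3) g r maps[OF calculation] by (auto simp: compact_nhd_def)
      ultimately show "g \<in> {f \<in> entire_functions. T f \<in> U}" using K(3) by auto
    qed
    with L show "\<exists>K e. compact K \<and> 0 < e \<and> compact_nhd f K e \<subseteq> {f \<in> entire_functions. T f \<in> U}"
      by blast
  qed auto
qed

lemma continuous_map_entire_topologyD:
  assumes "continuous_map entire_topology entire_topology T" "f \<in> entire_functions" "0 < e"
  obtains K d where "compact K" "0 < d" "\<And>g. g \<in> compact_nhd f K d \<Longrightarrow> T g \<in> compact_nhd (T f) (cball 0 r) e"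
proof -
  have Tf: "T f \<in> entire_functions"
    using assms by (auto simp: continuous_map_def topspace_entire_topology)
  have "openin entire_topology {g \<in> topspace entire_topology. T g \<in> compact_nhd (T f) (cball 0 r) e}"
    by (rule openin_continuous_map_preimage[OF assms(1) openin_compact_nhd[OF Tf compact_cball]])
  moreover have "f \<in> {g \<in> topspace entire_topology. T g \<in> compact_nhd (T f) (cball 0 r) e}"
    using assms Tf by (auto simp: topspace_entire_topology compact_nhd_def)
  ultimately obtain K d where "compact K" "0 < d"
     "compact_nhd f K d \<subseteq> {g \<in> topspace entire_topology. T g \<in> compact_nhd (T f) (cball 0 r) e}"
    unfolding openin_entire_topology by blast
  then show ?thesis using that by blast
qed

text \<open>Stability of powers, by uniform continuity of \<open>x \<mapsto> x\<^sup>i\<close> on bounded sets.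
  The perturbation \<open>v\<close> is arbitrary off the points considered, so the lemma serves both for entire
  functions and for holomorphic functions on a small disc.\<close>

lemma power_perturbation:
  fixes u :: "'a :: metric_space \<Rightarrow> complex"
  assumes "compact (u ` K)" "0 < e"
  obtains d where "0 < d" "\<And>v z. z \<in> K \<Longrightarrow> dist (v z) (u z) < d \<Longrightarrow> dist (v z ^ i) (u z ^ i) < e"
proof -
  obtain R where R: "u ` K \<subseteq> cball 0 R"
    using bounded_subset_ballD[OF compact_imp_bounded[OF assms(1)], of 0] ball_subset_cball by blast
  have "uniformly_continuous_on (cball (0::complex) (R + 1)) (\<lambda>x. x ^ i)"
    by (intro compact_uniformly_continuous continuous_intros compact_cball)
  then obtain d where d: "0 < d"
    "\<And>x y. x \<in> cball (0::complex) (R+1) \<Longrightarrow> y \<in> cball 0 (R+1) \<Longrightarrow> dist y x < d \<Longrightarrow> dist (y^i) (x^i) < e"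
    unfolding uniformly_continuous_on_def using assms(2) by meson
  show ?thesis
  proof (rule that[of "min d 1"])
    show "0 < min d 1" using d by simp
    fix v z assume z: "z \<in> K" "dist (v z) (u z) < min d 1"
    have "norm (u z) \<le> R" using R z by auto
    moreover have "norm (v z) \<le> norm (u z) + dist (v z) (u z)"
      by (metis dist_norm norm_triangle_sub)
    ultimately show "dist (v z ^ i) (u z ^ i) < e" using z by (intro d) auto
  qed
qed

lemma continuous_map_entire_power:
  "continuous_map entire_topology entire_topology (\<lambda>f z. f z ^ i)"
proof (rule continuous_map_entire_topologyI)
  fix f :: "complex \<Rightarrow> complex" and r e :: real assume f: "f \<in> entire_functions" "0 < e"
  have "compact (f ` cball 0 r)"
    by (intro compact_continuous_image entire_continuous_on f compact_cball)
  then obtain d where "0 < d" "\<And>v z. z \<in> cball 0 r \<Longrightarrow> dist (v z) (f z) < d \<Longrightarrow> dist (v z ^ i) (f z ^ i) < e"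
    using power_perturbation[of f "cball 0 r" e i] f(2) by metis
  then show "\<exists>K d. compact K \<and> 0 < d \<and>
        (\<forall>g\<in>compact_nhd f K d. \<forall>z\<in>cball 0 r. dist (g z ^ i) (f z ^ i) < e)"
    by (intro exI[of _ "cball 0 r"] exI[of _ d]) (auto simp: compact_nhd_def)
qed (rule entire_power)

lemma continuous_linear_operatorD:
  assumes "continuous_linear_operator T"
  shows "f \<in> entire_functions \<Longrightarrow> T f \<in> entire_functions"
    and "f \<in> entire_functions \<Longrightarrow> g \<in> entire_functions \<Longrightarrow> T (\<lambda>z. f z + g z) = (\<lambda>z. T f z + T g z)"
    and "f \<in> entire_functions \<Longrightarrow> T (\<lambda>z. c * f z) = (\<lambda>z. c * T f z)"
    and "continuous_map entire_topology entire_topology T"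
  using assms by (auto simp: continuous_linear_operator_def continuous_map_def topspace_entire_topology)

lemma continuous_linear_operator_sum:
  assumes T: "continuous_linear_operator T" and f: "\<And>i. i \<in> I \<Longrightarrow> f i \<in> entire_functions"
  shows "T (\<lambda>z. \<Sum>i\<in>I. a i * f i z) = (\<lambda>z. \<Sum>i\<in>I. a i * T (f i) z)"
proof -
  note D = continuous_linear_operatorD[OF T]
  have zero: "T (\<lambda>z. 0) = (\<lambda>z. 0)" using D(3)[of "\<lambda>z. 0" 0] entire_const by simp
  show ?thesis
    using f
  proof (induction I rule: infinite_finite_induct)
    case (insert x F)
    have "T (\<lambda>z. a x * f x z + (\<Sum>i\<in>F. a i * f i z)) =
       (\<lambda>z. T (\<lambda>z. a x * f x z) z + T (\<lambda>z. \<Sum>i\<in>F. a i * f i z) z)"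
      by (intro D entire_mult entire_const entire_sum insert) (use insert in auto)
    with insert D(3)[of "f x" "a x"] show ?case by simp
  qed (simp_all add: zero)
qed

lemma continuous_linear_operator_funpow:
  assumes T: "continuous_linear_operator T"
  shows "continuous_linear_operator (T ^^ k)"
proof (induction k)
  case 0
  show ?case by (simp add: continuous_linear_operator_def id_def flip: id_def)
next
  case (Suc k)
  note D = continuous_linear_operatorD[OF T] and E = continuous_linear_operatorD[OF Suc]
  show ?case unfolding continuous_linear_operator_def
    using continuous_map_compose[OF E(4) D(4)] E D by simp
qed

lemma continuous_linear_operator_add_scaled:
  assumes S: "continuous_linear_operator S" and T: "continuous_linear_operator T"
  shows "continuous_linear_operator (\<lambda>f z. S f z + c * T f z)"
proof -
  note S = continuous_linear_operatorD[OF S] and T = continuous_linear_operatorD[OF T]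
  have "continuous_map entire_topology entire_topology (\<lambda>f z. S f z + c * T f z)"
  proof (rule continuous_map_entire_topologyI)
    fix f r and e :: real assume f: "f \<in> entire_functions" "0 < e"
    obtain e' where e': "0 < e'" "norm c * e' \<le> e/2" "e' \<le> e/2"
      using small_factor[OF f(2) norm_ge_zero] by metis
    obtain K1 d1 where 1: "compact K1" "0 < d1"
      "\<And>g. g \<in> compact_nhd f K1 d1 \<Longrightarrow> S g \<in> compact_nhd (S f) (cball 0 r) e'"
      using continuous_map_entire_topologyD[OF S(4) f(1) e'(1), of r] by metis
    obtain K2 d2 where 2: "compact K2" "0 < d2"
      "\<And>g. g \<in> compact_nhd f K2 d2 \<Longrightarrow> T g \<in> compact_nhd (T f) (cball 0 r) e'"
      using continuous_map_entire_topologyD[OF T(4) f(1) e'(1), of r] by metis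
    have "dist (S g z + c * T g z) (S f z + c * T f z) < e"
      if g: "g \<in> compact_nhd f (K1 \<union> K2) (min d1 d2)" and z: "z \<in> cball 0 r" for g z
    proof -
      have "g \<in> compact_nhd f K1 d1" "g \<in> compact_nhd f K2 d2"
        using g by (auto simp: compact_nhd_def)
      then have a: "norm (S g z - S f z) < e'" "norm (T g z - T f z) < e'"
        using 1(3) 2(3) z by (auto simp: compact_nhd_def dist_norm)
      have "norm (S g z + c * T g z - (S f z + c * T f z)) \<le> norm (S g z - S f z) + norm (c * (T g z - T f z))"
        by (rule order_trans[OF _ norm_triangle_ineq]) (simp add: algebra_simps)
      also have "\<dots> \<le> norm (S g z - S f z) + norm c * e'"
        using a by (auto simp: norm_mult intro!: mult_left_mono)
      also have "\<dots> < e" using a e' by linarith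
      finally show ?thesis by (simp add: dist_norm)
    qed
    with 1 2 show "\<exists>K d. compact K \<and> 0 < d \<and>
      (\<forall>g\<in>compact_nhd f K d. \<forall>z\<in>cball 0 r. dist (S g z + c * T g z) (S f z + c * T f z) < e)"
      by (intro exI[of _ "K1 \<union> K2"] exI[of _ "min d1 d2"]) auto
  qed (intro entire_add entire_mult entire_const S T)
  then show ?thesis unfolding continuous_linear_operator_def
    by (auto simp: S T algebra_simps)
qed

text \<open>Cauchy's inequality on unit discs bounds the derivatives on \<open>cball 0 r\<close> by the function on
  \<open>cball 0 (r + 1)\<close>.\<close>

lemma continuous_linear_operator_scaled_deriv: "continuous_linear_operator (scaled_deriv N)"
proof -
  have hol: "f holomorphic_on S" if "f \<in> entire_functions" for f S
    using that holomorphic_on_subset by (auto simp: entire_functions_def)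
  have "continuous_map entire_topology entire_topology (scaled_deriv N)"
  proof (rule continuous_map_entire_topologyI)
    fix f r and e :: real assume f: "f \<in> entire_functions" "0 < e"
    have "dist (scaled_deriv N g z) (scaled_deriv N f z) < e"
      if g: "g \<in> compact_nhd f (cball 0 (r+1)) (e/2)" and z: "z \<in> cball 0 r" for g z
    proof -
      have gE: "g \<in> entire_functions" using g by (simp add: compact_nhd_def)
      have "norm ((deriv ^^ N) (\<lambda>w. g w - f w) z) \<le> fact N * (e/2) / 1 ^ N"
      proof (rule Cauchy_inequality)
        fix x assume "norm (z - x) = 1"
        then have "norm x \<le> r + 1"
          using z norm_triangle_ineq4[of z "z - x"] by simp
        then show "norm (g x - f x) \<le> e/2" using g by (force simp: compact_nhd_def dist_norm)
      qed (auto intro!: hol entire_diff gE f entire_continuous_on)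
      moreover have "(deriv ^^ N) (\<lambda>w. g w - f w) z = (deriv ^^ N) g z - (deriv ^^ N) f z"
        by (rule higher_deriv_diff[of _ UNIV]) (auto intro: hol gE f)
      ultimately have "norm ((deriv ^^ N) g z - (deriv ^^ N) f z) / fact N \<le> e / 2"
        by (simp add: field_simps)
      then have "norm (((deriv ^^ N) g z - (deriv ^^ N) f z) / fact N) \<le> e / 2"
        by (simp add: norm_divide)
      then have "norm (scaled_deriv N g z - scaled_deriv N f z) \<le> e / 2"
        by (simp add: scaled_deriv_def diff_divide_distrib)
      with f show ?thesis by (simp add: dist_norm)
    qed
    with f show "\<exists>K d. compact K \<and> 0 < d \<and>
      (\<forall>g\<in>compact_nhd f K d. \<forall>z\<in>cball 0 r. dist (scaled_deriv N g z) (scaled_deriv N f z) < e)"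
      by (intro exI[of _ "cball 0 (r+1)"] exI[of _ "e/2"]) auto
  qed (unfold scaled_deriv_def, intro entire_mult entire_const entire_higher_deriv)
  moreover have "(deriv ^^ N) (\<lambda>z. f z + g z) z = (deriv ^^ N) f z + (deriv ^^ N) g z"
    if "f \<in> entire_functions" "g \<in> entire_functions" for f g z
    by (rule higher_deriv_add[of _ UNIV]) (auto intro: hol that)
  moreover have "(deriv ^^ N) (\<lambda>z. c * f z) z = c * (deriv ^^ N) f z"
    if "f \<in> entire_functions" for f c z
    by (rule higher_deriv_cmult[of _ UNIV]) (auto intro: hol that)
  ultimately show ?thesis
    by (auto simp: continuous_linear_operator_def scaled_deriv_def add_divide_distrib)
qed

lemma polynomial_approximation_on_ball:
  assumes f: "f holomorphic_on ball 0 R" and r: "r < R" and e: "0 < e"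
  obtains p :: "complex poly" where "\<And>z. z \<in> cball 0 r \<Longrightarrow> dist (poly p z) (f z) < e"
proof -
  define a where "a = (\<lambda>n. (deriv ^^ n) f 0 / fact n)"
  have sm: "(\<lambda>n. a n * z ^ n) sums f z" if "z \<in> ball 0 R" for z :: complex
    using holomorphic_power_series[OF f that] by (simp add: a_def)
  have *: "ereal r < conv_radius a" if "0 \<le> r"
  proof -
    define s where "s = (r + R) / 2"
    have "summable (\<lambda>n. a n * of_real s ^ n)"
      using sm[of "of_real s"] r that by (simp add: s_def sums_iff del: of_real_add of_real_divide)
    then have "ereal (norm (of_real s :: complex)) \<le> conv_radius a" by (rule conv_radius_geI)
    moreover have "r < norm (of_real s :: complex)"
      unfolding norm_of_real using r that by (simp add: s_def)
    ultimately show ?thesis by (meson less_ereal.simps(1) less_le_trans)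
  qed
  show ?thesis
  proof (cases "0 \<le> r")
    case True
    have "uniform_limit (cball 0 r) (\<lambda>n x. \<Sum>i<n. a i * (x - 0) ^ i) (\<lambda>x. suminf (\<lambda>i. a i * (x - 0) ^ i)) sequentially"
      by (rule powser_uniform_limit[OF *[OF True]])
    then have "\<forall>\<^sub>F n in sequentially. \<forall>x\<in>cball 0 r. dist (\<Sum>i<n. a i * x ^ i) (\<Sum>i. a i * x ^ i) < e"
      using e by (auto simp: uniform_limit_iff)
    then obtain n where n: "\<And>x. x \<in> cball 0 r \<Longrightarrow> dist (\<Sum>i<n. a i * x ^ i) (\<Sum>i. a i * x ^ i) < e"
      unfolding eventually_sequentially by blast
    show ?thesis
    proof (rule that[of "\<Sum>i<n. monom (a i) i"])
      fix z :: complex assume z: "z \<in> cball 0 r"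
      have "(\<Sum>i. a i * z ^ i) = f z" using sm[of z] z r by (auto simp: sums_iff)
      then show "dist (poly (\<Sum>i<n. monom (a i) i) z) (f z) < e"
        using n[OF z] by (simp add: poly_sum poly_monom)
    qed
  qed (use that in auto)
qed

lemma polynomials_dense:
  assumes "f \<in> entire_functions" "0 < e"
  obtains p :: "complex poly" where "poly p \<in> compact_nhd f (cball 0 r) e"
proof -
  have "f holomorphic_on ball 0 (r+1)"
    using assms holomorphic_on_subset by (auto simp: entire_functions_def)
  then obtain p :: "complex poly" where "\<And>z. z \<in> cball 0 r \<Longrightarrow> dist (poly p z) (f z) < e"
    using polynomial_approximation_on_ball[of f "r+1" r e] assms(2) by auto
  then show ?thesis using that[of p] by (simp add: compact_nhd_def entire_poly)
qed

text \<open>The polynomials whose coefficients lie in a countable dense set of complex numbers. Coefficients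
  are adjusted one at a time, Horner style: an error \<open>d\<close> in the tail costs at most
  \<open>\<bar>r\<bar> * d\<close> after multiplication by \<open>z\<close>.\<close>

lemma countable_dense_subset:
  obtains D where "countable D" "D \<subseteq> entire_functions"
    "\<And>f r e. f \<in> entire_functions \<Longrightarrow> 0 < e \<Longrightarrow> \<exists>g\<in>D. g \<in> compact_nhd f (cball 0 r) e"
proof -
  obtain Q :: "complex set" where Q: "countable Q"
    "\<And>X. open X \<Longrightarrow> X \<noteq> {} \<Longrightarrow> \<exists>d\<in>Q. d \<in> X"
    using countable_dense_exists[where 'a=complex] by metis
  define D where "D = (\<lambda>xs. poly (Poly xs)) ` lists Q"
  have approx: "\<exists>ys\<in>lists Q. \<forall>z\<in>cball 0 r. dist (poly (Poly ys) z) (poly (Poly xs) z) < e"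
    if "0 < e" for xs :: "complex list" and e r :: real
    using that
  proof (induction xs arbitrary: e)
    case Nil
    show ?case by (rule bexI[of _ "[]"]) (use Nil in auto)
  next
    case (Cons x xs)
    obtain y where y: "y \<in> Q" "dist y x < e/2"
      using Q(2)[of "ball x (e/2)"] Cons.prems by (auto simp: dist_commute)
    obtain e' where "0 < e'" "\<bar>r\<bar> * e' \<le> e / 2"
      using small_factor[OF Cons.prems abs_ge_zero] by metis
    with Cons.IH[of e'] obtain ys where ys: "ys \<in> lists Q"
      "\<And>z. z \<in> cball 0 r \<Longrightarrow> dist (poly (Poly ys) z) (poly (Poly xs) z) < e'" by blast
    show ?case
    proof (rule bexI[of _ "y # ys"], rule ballI)
      fix z :: complex assume z: "z \<in> cball 0 r"
      have "norm (poly (Poly (y#ys)) z - poly (Poly (x#xs)) z)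
          = norm ((y - x) + z * (poly (Poly ys) z - poly (Poly xs) z))"
        by (simp add: algebra_simps)
      also have "\<dots> \<le> norm (y - x) + norm z * norm (poly (Poly ys) z - poly (Poly xs) z)"
        by (metis norm_mult norm_triangle_ineq)
      also have "\<dots> \<le> norm (y - x) + \<bar>r\<bar> * e'"
        using ys(2)[OF z] z by (intro add_left_mono mult_mono) (auto simp: dist_norm)
      also have "\<dots> < e" using y \<open>\<bar>r\<bar> * e' \<le> e / 2\<close> by (simp add: dist_norm)
      finally show "dist (poly (Poly (y#ys)) z) (poly (Poly (x#xs)) z) < e" by (simp add: dist_norm)
    qed (use y ys in auto)
  qed
  show ?thesis
  proof (rule that[of D])
    show "countable D" unfolding D_def by (intro countable_image countable_lists Q)
    show "D \<subseteq> entire_functions" by (auto simp: D_def entire_poly)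
    fix f r and e :: real assume f: "f \<in> entire_functions" "0 < e"
    then obtain p where p: "poly p \<in> compact_nhd f (cball 0 r) (e/2)"
      using polynomials_dense[of f "e/2" r] by auto
    obtain ys where ys: "ys \<in> lists Q"
      "\<And>z. z \<in> cball 0 r \<Longrightarrow> dist (poly (Poly ys) z) (poly p z) < e/2"
      using approx[of "e/2" r "coeffs p"] f(2) by (metis Poly_coeffs half_gt_zero)
    have "dist (poly (Poly ys) z) (f z) < e" if "z \<in> cball 0 r" for z
      using dist_triangle_half_r[of "poly p z" "poly (Poly ys) z" e "f z"] ys(2)[OF that] p that
      by (auto simp: compact_nhd_def dist_commute)
    then have "poly (Poly ys) \<in> compact_nhd f (cball 0 r) e"
      by (simp add: compact_nhd_def entire_poly)
    then show "\<exists>g\<in>D. g \<in> compact_nhd f (cball 0 r) e" using ys by (auto simp: D_def)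
  qed
qed

lemma uniform_limit_sum_family:
  fixes f :: "'i \<Rightarrow> 'a \<Rightarrow> 'b \<Rightarrow> complex"
  assumes "\<And>i. i \<in> I \<Longrightarrow> uniform_limit S (f i) (g i) F"
  shows "uniform_limit S (\<lambda>k z. \<Sum>i\<in>I. f i k z) (\<lambda>z. \<Sum>i\<in>I. g i z) F"
  using assms
  by (induction I rule: infinite_finite_induct) (auto intro!: uniform_limit_add uniform_limit_const)

lemma uniform_limit_cmult:
  fixes f :: "'a \<Rightarrow> 'b \<Rightarrow> complex"
  assumes "uniform_limit S f g F"
  shows "uniform_limit S (\<lambda>k z. c * f k z) (\<lambda>z. c * g z) F"
  by (rule bounded_linear.uniform_limit[OF bounded_linear_mult_right assms])

section \<open>A Baire argument and a criterion for hypercyclic algebras\<close>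

text \<open>The Baire property in the only form needed here: countably many dense open sets have a common
  point. Neighbourhoods \<open>compact_nhd (f k) (cball 0 (r k)) (e k)\<close> are nested with radii
  \<open>r k\<close> tending to infinity and tolerances \<open>e k\<close> tending to zero, so the centres converge locally
  uniformly and Weierstrass' theorem makes the limit entire.\<close>

lemma entire_Baire:
  fixes G :: "nat \<Rightarrow> (complex \<Rightarrow> complex) set"
  assumes opn: "\<And>k. openin entire_topology (G k)"
    and dense: "\<And>k f r e. f \<in> entire_functions \<Longrightarrow> 0 < e \<Longrightarrow> G k \<inter> compact_nhd f (cball 0 r) e \<noteq> {}"
  obtains F where "F \<in> entire_functions" "\<And>k. F \<in> G k"
proof -
  \<comment> \<open>The factors 2 leave room: the centres stay at distance less than \<open>e k\<close>, their limit at distance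
      at most \<open>e k\<close>, hence inside the neighbourhood of size \<open>2 * e k\<close>.\<close>
  define P where "P = (\<lambda>(k::nat) (f::complex\<Rightarrow>complex, r::real, e::real). f \<in> entire_functions \<and> 0 < e)"
  define Q where "Q = (\<lambda>k (f::complex\<Rightarrow>complex, r::real, e::real) (f', r', e').
     r + 1 \<le> r' \<and> e' \<le> e / 2 \<and> f' \<in> compact_nhd f (cball 0 r) (e/2) \<and>
     compact_nhd f' (cball 0 r') (2 * e') \<subseteq> G k)"
  have "\<exists>x. P 0 x" by (auto simp: P_def intro!: exI[of _ "\<lambda>z. 0"] exI[of _ "1::real"] entire_const)
  moreover have "\<exists>y. P (Suc k) y \<and> Q k x y" if x: "P k x" for k x
  proof -
    obtain f r e where [simp]: "x = (f, r, e)" by (cases x)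
    have f: "f \<in> entire_functions" "0 < e" using x by (auto simp: P_def)
    then obtain f' where f': "f' \<in> G k" "f' \<in> compact_nhd f (cball 0 r) (e/2)"
      using dense[of f "e/2" k r] by auto
    then obtain K d where K: "compact K" "0 < d" "compact_nhd f' K d \<subseteq> G k"
      using opn[of k] unfolding openin_entire_topology by blast
    obtain R where R: "K \<subseteq> cball 0 R"
      using bounded_subset_ballD[OF compact_imp_bounded[OF K(1)], of 0] ball_subset_cball by blast
    define r' where "r' = max R (r + 1)"
    define e' where "e' = min (d / 2) (e / 2)"
    have "compact_nhd f' (cball 0 r') (2 * e') \<subseteq> compact_nhd f' K d"
      using R by (intro compact_nhd_mono) (auto simp: r'_def e'_def)
    then have "P (Suc k) (f', r', e') \<and> Q k x (f', r', e')"
      using f f' K by (auto simp: P_def Q_def r'_def e'_def compact_nhd_def)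
    then show ?thesis by blast
  qed
  ultimately obtain X where X: "\<And>k. P k (X k)" "\<And>k. Q k (X k) (X (Suc k))"
    using dependent_nat_choice[of P Q] by blast
  define f where "f = (\<lambda>k. fst (X k))"
  define r where "r = (\<lambda>k. fst (snd (X k)))"
  define e where "e = (\<lambda>k. snd (snd (X k)))"
  have XE: "X k = (f k, r k, e k)" for k by (simp add: f_def r_def e_def)
  have f: "f k \<in> entire_functions" and e: "0 < e k" for k using X(1)[of k] by (auto simp: XE P_def)
  have r1: "r k + 1 \<le> r (Suc k)" and e1: "e (Suc k) \<le> e k / 2"
    and near: "f (Suc k) \<in> compact_nhd (f k) (cball 0 (r k)) (e k / 2)"
    and sub: "compact_nhd (f (Suc k)) (cball 0 (r (Suc k))) (2 * e (Suc k)) \<subseteq> G k" for k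
    using X(2)[of k] by (auto simp: XE Q_def)
  have stay: "f (k + l) \<in> compact_nhd (f k) (cball 0 (r k)) (e k)" for k l
  proof (induction l arbitrary: k)
    case 0
    show ?case using f e by (simp add: compact_nhd_def)
  next
    case (Suc l)
    have "dist (f (k + Suc l) z) (f k z) < e k" if z: "z \<in> cball 0 (r k)" for z
    proof -
      have "dist (f (Suc k + l) z) (f (Suc k) z) < e (Suc k)"
        using Suc[of "Suc k"] z r1[of k] by (auto simp: compact_nhd_def)
      moreover have "dist (f (Suc k) z) (f k z) < e k / 2"
        using near[of k] z by (auto simp: compact_nhd_def)
      ultimately show ?thesis
        using dist_triangle[of "f (k + Suc l) z" "f k z" "f (Suc k) z"] e1[of k] by simp
    qed
    then show ?case using f by (simp add: compact_nhd_def)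
  qed
  have rk: "r 0 + real k \<le> r k" for k
  proof (induction k)
    case (Suc k)
    then show ?case using r1[of k] by simp
  qed simp
  have ek: "e k \<le> e 0 * (1/2) ^ k" for k
  proof (induction k)
    case (Suc k)
    then show ?case using e1[of k] by simp
  qed simp
  have e0: "e \<longlonglongrightarrow> 0"
  proof (rule tendsto_sandwich[of "\<lambda>_. 0" _ _ "\<lambda>k. e 0 * (1/2) ^ k"])
    show "(\<lambda>k. e 0 * (1/2) ^ k) \<longlonglongrightarrow> 0" by (intro tendsto_mult_right_zero LIMSEQ_power_zero) simp
  qed (use e ek in \<open>auto intro!: always_eventually less_imp_le\<close>)
  have large: "\<exists>k0. \<forall>k\<ge>k0. R \<le> r k \<and> e k < d" if d: "0 < d" for R d
  proof -
    obtain k1 :: nat where k1: "R - r 0 \<le> real k1" using real_arch_simple by blast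
    obtain k2 where k2: "\<forall>k\<ge>k2. e k < d"
      using order_tendstoD(2)[OF e0, of d] d unfolding eventually_sequentially by blast
    have "R \<le> r k \<and> e k < d" if "k \<ge> max k1 k2" for k
    proof -
      have "real k1 \<le> real k" using that by simp
      then show ?thesis using k1 k2 rk[of k] that by auto
    qed
    then show ?thesis by blast
  qed
  have "Cauchy (\<lambda>k. f k z)" for z
  proof (rule metric_CauchyI)
    fix d :: real assume "0 < d"
    then obtain k where k: "norm z \<le> r k" "e k < d/2" using large[of "d/2" "norm z"] by auto
    have "dist (f i z) (f k z) < d/2" if "k \<le> i" for i
    proof -
      have "dist (f i z) (f k z) < e k" using stay[of k "i - k"] that k(1) by (auto simp: compact_nhd_def)
      with k(2) show ?thesis by simp
    qed
    then show "\<exists>M. \<forall>i\<ge>M. \<forall>j\<ge>M. dist (f i z) (f j z) < d"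
      by (meson dist_triangle_half_l dist_commute)
  qed
  then have lim: "(\<lambda>k. f k z) \<longlonglongrightarrow> lim (\<lambda>k. f k z)" for z
    using Cauchy_convergent convergent_LIMSEQ_iff by blast
  define F where "F = (\<lambda>z. lim (\<lambda>k. f k z))"
  have dF: "dist (F z) (f k z) \<le> e k" if "z \<in> cball 0 (r k)" for z k
  proof -
    have "dist (f k z) (f i z) \<le> e k" if "k \<le> i" for i
      using stay[of k "i - k"] that \<open>z \<in> cball 0 (r k)\<close> by (auto simp: compact_nhd_def dist_commute intro: less_imp_le)
    then have "\<forall>\<^sub>F i in sequentially. dist (f k z) (f i z) \<le> e k"
      unfolding eventually_sequentially by blast
    then have "dist (f k z) (F z) \<le> e k"
      unfolding F_def by (rule Lim_dist_ubound[OF trivial_limit_sequentially lim])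
    then show ?thesis by (simp add: dist_commute)
  qed
  have "F holomorphic_on UNIV"
  proof (rule holomorphic_uniform_sequence[of UNIV f])
    show "f k holomorphic_on UNIV" for k using f[of k] by (simp add: entire_functions_def)
    fix x :: complex
    have "uniform_limit (cball x 1) f F sequentially"
      unfolding uniform_limit_iff
    proof (intro allI impI)
      fix d :: real assume "0 < d"
      then obtain k0 where k0: "\<And>k. k \<ge> k0 \<Longrightarrow> norm x + 1 \<le> r k \<and> e k < d"
        using large[of d "norm x + 1"] by blast
      have "dist (f k y) (F y) < d" if "k \<ge> k0" "y \<in> cball x 1" for k y
      proof -
        have "norm y \<le> norm x + dist x y" by (metis dist_commute dist_norm norm_triangle_sub)
        then have "y \<in> cball 0 (r k)" using that k0[of k] by auto
        from dF[OF this] show ?thesis using k0[of k] that by (simp add: dist_commute)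
      qed
      then show "\<forall>\<^sub>F k in sequentially. \<forall>y\<in>cball x 1. dist (f k y) (F y) < d"
        unfolding eventually_sequentially by blast
    qed
    then show "\<exists>d. 0 < d \<and> cball x d \<subseteq> UNIV \<and> uniform_limit (cball x d) f F sequentially"
      by (intro exI[of _ 1]) auto
  qed simp
  then have F: "F \<in> entire_functions" by (simp add: entire_functions_def)
  have "F \<in> G k" for k
  proof -
    have "F \<in> compact_nhd (f (Suc k)) (cball 0 (r (Suc k))) (2 * e (Suc k))"
    proof -
      have "dist (F z) (f (Suc k) z) < 2 * e (Suc k)" if "z \<in> cball 0 (r (Suc k))" for z
        using dF[OF that] e[of "Suc k"] by linarith
      then show ?thesis using F by (simp add: compact_nhd_def)
    qed
    then show ?thesis using sub by blast
  qed
  with F show ?thesis using that by blast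
qed

text \<open>If for each \<open>m\<close> one iterate can send \<open>u\<^sup>m\<close> close to any target while sending the lower powers of
  \<open>u\<close> close to zero, then by Baire some single \<open>u\<close> does so for all \<open>m\<close>, targets and tolerances.
  The nonunital algebra generated by this \<open>u\<close> is hypercyclic: along such iterates the orbit of
  \<open>\<Sum>i\<le>m. a i * u\<^sup>i\<close> only sees the leading term, so aiming \<open>u\<^sup>m\<close> at \<open>h / a m\<close> brings it
  close to \<open>h\<close>.\<close>

theorem hypercyclic_algebra_criterion:
  assumes T: "continuous_linear_operator T"
    and step: "\<And>m f g r e. \<lbrakk>1 \<le> m; f \<in> entire_functions; g \<in> entire_functions; 0 < e\<rbrakk> \<Longrightarrow>
      \<exists>u\<in>compact_nhd f (cball 0 r) e. \<exists>q. \<forall>i\<in>{1..m}.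
        (T ^^ q) (\<lambda>z. u z ^ i) \<in> compact_nhd (if i = m then g else (\<lambda>z. 0)) (cball 0 r) e"
  shows "supports_hypercyclic_algebra T"
proof -
  note Tq = continuous_linear_operatorD[OF continuous_linear_operator_funpow[OF T]]
  define target :: "nat \<Rightarrow> (complex \<Rightarrow> complex) \<Rightarrow> nat \<Rightarrow> complex \<Rightarrow> complex"
    where "target = (\<lambda>m g i. if i = m then g else (\<lambda>z. 0))"
  have target: "target m g i \<in> entire_functions" if "g \<in> entire_functions" for m g i
    using that by (auto simp: target_def entire_const)
  obtain D where D: "countable D" "D \<subseteq> entire_functions"
    "\<And>f r e. f \<in> entire_functions \<Longrightarrow> 0 < e \<Longrightarrow> \<exists>g\<in>D. g \<in> compact_nhd f (cball 0 r) e"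
    using countable_dense_subset by blast
  \<comment> \<open>One number \<open>j\<close> serves as radius and as inverse tolerance, so the conditions are countably many.\<close>
  define Good where "Good = (\<lambda>(m, g, j). \<Union>q. \<Inter>i\<in>{1..m}. {u \<in> topspace entire_topology.
      ((T ^^ q) \<circ> (\<lambda>f z. f z ^ i)) u \<in> compact_nhd (target m g i) (cball 0 (real j)) (1 / Suc j)})"
  define I where "I = {1::nat..} \<times> D \<times> (UNIV :: nat set)"
  have "countable I" using D(1) by (auto simp: I_def)
  have "I \<noteq> {}" using D(3)[OF entire_const[of 0], of 1] by (auto simp: I_def)
  have open_Good: "openin entire_topology (Good x)" if x: "x \<in> I" for x
  proof -
    obtain m g j where [simp]: "x = (m, g, j)" by (cases x)
    have g: "1 \<le> m" "g \<in> entire_functions" using x D(2) by (auto simp: I_def)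
    have "openin entire_topology {u \<in> topspace entire_topology.
      ((T ^^ q) \<circ> (\<lambda>f z. f z ^ i)) u \<in> compact_nhd (target m g i) (cball 0 (real j)) (1 / Suc j)}" for i q
      by (rule openin_continuous_map_preimage[OF continuous_map_compose[OF continuous_map_entire_power Tq(4)]
          openin_compact_nhd[OF target[OF g(2)] compact_cball]])
    then show ?thesis unfolding Good_def using g by (auto intro!: openin_INT2)
  qed
  have dense_Good: "Good x \<inter> compact_nhd f (cball 0 r) e \<noteq> {}"
    if x: "x \<in> I" and f: "f \<in> entire_functions" "0 < e" for x f r e
  proof -
    obtain m g j where [simp]: "x = (m, g, j)" by (cases x)
    have g: "1 \<le> m" "g \<in> entire_functions" using x D(2) by (auto simp: I_def)
    define e' where "e' = min e (1 / Suc j)"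
    define r' where "r' = max r (real j)"
    have e': "0 < e'" "e' \<le> e" "e' \<le> 1 / Suc j" and r': "r \<le> r'" "real j \<le> r'"
      using f by (auto simp: e'_def r'_def)
    obtain u q where u: "u \<in> compact_nhd f (cball 0 r') e'"
      "\<And>i. i \<in> {1..m} \<Longrightarrow> (T ^^ q) (\<lambda>z. u z ^ i) \<in> compact_nhd (target m g i) (cball 0 r') e'"
      using step[OF g(1) f(1) g(2) e'(1), of r'] unfolding target_def by blast
    have shrink: "compact_nhd h (cball 0 r') e' \<subseteq> compact_nhd h (cball 0 s) d"
      if "s \<le> r'" "e' \<le> d" for h s d
      using that by (intro compact_nhd_mono) auto
    have "u \<in> Good x"
      using u(1) u(2)[THEN subsetD[OF shrink[OF r'(2) e'(3)]]]
      by (auto simp: Good_def topspace_entire_topology compact_nhd_def[of f] intro!: exI[of _ q])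
    moreover have "u \<in> compact_nhd f (cball 0 r) e" using u(1) shrink[OF r'(1) e'(2)] by blast
    ultimately show ?thesis by blast
  qed
  obtain u where u: "u \<in> entire_functions" "\<And>k. u \<in> Good (from_nat_into I k)"
    using entire_Baire[of "\<lambda>k. Good (from_nat_into I k)"] open_Good dense_Good from_nat_into[OF \<open>I \<noteq> {}\<close>]
    by (metis (no_types, lifting))
  have uGood: "u \<in> Good x" if "x \<in> I" for x
    using u(2) from_nat_into_surj[OF \<open>countable I\<close> that] by metis
  have univ: "\<exists>q. \<forall>i\<in>{1..m}. (T ^^ q) (\<lambda>z. u z ^ i) \<in> compact_nhd (target m h i) (cball 0 r) e"
    if m: "1 \<le> m" and h: "h \<in> entire_functions" "0 < e" for m h r e
  proof -
    obtain g where g: "g \<in> D" "g \<in> compact_nhd h (cball 0 r) (e/2)"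
      using D(3)[OF h(1), of "e/2" r] h(2) by auto
    obtain j1 :: nat where j1: "r \<le> real j1" using real_arch_simple by blast
    obtain j2 :: nat where j2: "1 / Suc j2 < e/2" using nat_approx_posE[of "e/2"] h(2) by auto
    define j where "j = max j1 j2"
    have "1 / Suc j \<le> 1 / Suc j2" by (auto simp: j_def frac_le)
    then have j: "r \<le> real j" "1 / Suc j < e/2" using j1 j2 by (auto simp: j_def)
    have "u \<in> Good (m, g, j)" using g(1) m by (intro uGood) (simp add: I_def)
    then obtain q where q: "\<And>i. i \<in> {1..m} \<Longrightarrow>
       (T ^^ q) (\<lambda>z. u z ^ i) \<in> compact_nhd (target m g i) (cball 0 (real j)) (1 / Suc j)"
      unfolding Good_def o_def prod.case by fast
    have "(T ^^ q) (\<lambda>z. u z ^ i) \<in> compact_nhd (target m h i) (cball 0 r) e" if i: "i \<in> {1..m}" for i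
    proof -
      have "dist ((T ^^ q) (\<lambda>z. u z ^ i) z) (target m h i z) < e" if z: "z \<in> cball 0 r" for z
      proof -
        have "dist ((T ^^ q) (\<lambda>z. u z ^ i) z) (target m g i z) < 1 / Suc j"
          using q[OF i] z j(1) by (auto simp: compact_nhd_def)
        also note j(2)
        finally have "dist ((T ^^ q) (\<lambda>z. u z ^ i) z) (target m g i z) < e/2" .
        moreover have "dist (target m g i z) (target m h i z) < e/2"
          using g(2) z h(2) by (auto simp: compact_nhd_def target_def)
        ultimately show ?thesis
          using dist_triangle[of _ "target m h i z" "target m g i z"] by (smt (verit) field_sum_of_halves)
      qed
      then show ?thesis using q[OF i] by (simp add: compact_nhd_def)
    qed
    then show ?thesis by blast
  qed
  define M where "M = {(\<lambda>z. poly p (u z)) | p. coeff p 0 = 0}"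
  have "is_subalgebra M"
    unfolding is_subalgebra_def
  proof (intro conjI ballI allI)
    show "M \<subseteq> entire_functions" using u(1) by (auto simp: M_def entire_poly_compose)
    show "(\<lambda>z. 0) \<in> M" by (auto simp: M_def intro!: exI[of _ 0])
    fix f g c assume "f \<in> M" "g \<in> M"
    then obtain p s where "f = (\<lambda>z. poly p (u z))" "coeff p 0 = 0" "g = (\<lambda>z. poly s (u z))" "coeff s 0 = 0"
      by (auto simp: M_def)
    then show "(\<lambda>z. f z + g z) \<in> M" "(\<lambda>z. f z * g z) \<in> M"
      by (auto simp: M_def coeff_mult_0 intro: exI[of _ "p + s"] exI[of _ "p * s"])
  next
    fix f c assume "f \<in> M"
    then obtain p where "f = (\<lambda>z. poly p (u z))" "coeff p 0 = 0" by (auto simp: M_def)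
    then show "(\<lambda>z. c * f z) \<in> M" by (auto simp: M_def intro: exI[of _ "smult c p"])
  qed
  moreover have "M \<noteq> {\<lambda>z. 0}"
  proof
    \<comment> \<open>The orbit of the zero function cannot approach the constant 1.\<close>
    assume "M = {\<lambda>z. 0}"
    moreover have "u \<in> M" by (auto simp: M_def intro!: exI[of _ "[:0, 1:]"])
    ultimately have u0: "u = (\<lambda>z. 0)" by simp
    obtain q where "(T ^^ q) (\<lambda>z. u z ^ 1) \<in> compact_nhd (\<lambda>z. 1) (cball 0 1) 1"
      using univ[of 1 "\<lambda>z. 1" 1 1] entire_const by (auto simp: target_def)
    moreover have "(T ^^ q) (\<lambda>z. u z ^ 1) = (\<lambda>z. 0)"
      using Tq(3)[of "\<lambda>z. 0" q 0] entire_const by (simp add: u0)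
    ultimately have "\<forall>z. \<not> norm (z::complex) \<le> 1" by (simp add: compact_nhd_def)
    then show False by (metis norm_zero zero_le_one)
  qed
  moreover have "M \<subseteq> hypercyclic_vectors entire_topology T \<union> {\<lambda>z. 0}"
  proof
    fix v assume "v \<in> M"
    then obtain p where p: "v = (\<lambda>z. poly p (u z))" "coeff p 0 = 0" by (auto simp: M_def)
    show "v \<in> hypercyclic_vectors entire_topology T \<union> {\<lambda>z. 0}"
    proof (cases "p = 0")
      case False
      define m where "m = degree p"
      define a where "a = lead_coeff p"
      have a: "a \<noteq> 0" using False by (simp add: a_def)
      have m: "1 \<le> m" using False p(2) by (metis One_nat_def Suc_leI a_def a m_def neq0_conv)
      define C where "C = (\<Sum>i\<in>{1..m}. norm (coeff p i))"
      have C: "0 \<le> C" by (simp add: C_def sum_nonneg)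
      have orbit: "\<exists>q. (T ^^ q) v \<in> compact_nhd h (cball 0 r) e"
        if h: "h \<in> entire_functions" "0 < e" for h r e
      proof -
        obtain d where d: "0 < d" "C * d \<le> e / 2" using small_factor[OF h(2) C] by metis
        define g where "g = (\<lambda>z. (1 / a) * h z)"
        have g: "g \<in> entire_functions" unfolding g_def by (intro entire_mult entire_const h)
        obtain q where q: "\<And>i. i \<in> {1..m} \<Longrightarrow> (T ^^ q) (\<lambda>z. u z ^ i) \<in> compact_nhd (target m g i) (cball 0 r) d"
          using univ[OF m g d(1), of r] by blast
        have "v = (\<lambda>z. \<Sum>i\<in>{1..m}. coeff p i * u z ^ i)"
          unfolding p(1) poly_altdef m_def[symmetric]
          by (intro ext sum.mono_neutral_right) (auto simp: p(2) not_less_eq_eq)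
        then have Tv: "(T ^^ q) v = (\<lambda>z. \<Sum>i\<in>{1..m}. coeff p i * (T ^^ q) (\<lambda>z. u z ^ i) z)"
          using continuous_linear_operator_sum[OF continuous_linear_operator_funpow[OF T],
            of "{1..m}" "\<lambda>i z. u z ^ i" q "coeff p"] entire_power[OF u(1)] by simp
        have "dist ((T ^^ q) v z) (h z) < e" if z: "z \<in> cball 0 r" for z
        proof -
          have "h z = (\<Sum>i\<in>{1..m}. coeff p i * target m g i z)"
          proof -
            have "(\<Sum>i\<in>{1..m}. coeff p i * target m g i z) = (\<Sum>i\<in>{1..m}. if i = m then coeff p i * g z else 0)"
              by (intro sum.cong) (auto simp: target_def)
            also have "\<dots> = a * g z" using m by (simp add: a_def m_def)
            finally show ?thesis using a by (simp add: g_def)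
          qed
          then have "(T ^^ q) v z - h z =
             (\<Sum>i\<in>{1..m}. coeff p i * ((T ^^ q) (\<lambda>z. u z ^ i) z - target m g i z))"
            by (simp add: Tv sum_subtractf algebra_simps)
          also have "norm \<dots> \<le> (\<Sum>i\<in>{1..m}. norm (coeff p i) * d)"
          proof (rule sum_norm_le)
            fix i assume "i \<in> {1..m}"
            then have "norm ((T ^^ q) (\<lambda>z. u z ^ i) z - target m g i z) \<le> d"
              using q[of i] z by (auto simp: compact_nhd_def dist_norm intro: less_imp_le)
            then show "norm (coeff p i * ((T ^^ q) (\<lambda>z. u z ^ i) z - target m g i z)) \<le> norm (coeff p i) * d"
              by (simp add: norm_mult mult_left_mono)
          qed
          also have "\<dots> < e" using d h(2) by (simp add: C_def flip: sum_distrib_right)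
          finally show ?thesis by (simp add: dist_norm)
        qed
        moreover have "v \<in> entire_functions" unfolding p(1) by (intro entire_poly_compose u)
        ultimately have "(T ^^ q) v \<in> compact_nhd h (cball 0 r) e" using Tq(1) by (simp add: compact_nhd_def)
        then show ?thesis by blast
      qed
      have "entire_topology closure_of {(T ^^ q) v | q. True} = topspace entire_topology"
      proof (rule subset_antisym[OF closure_of_subset_topspace], rule subsetI)
        fix h assume h: "h \<in> topspace entire_topology"
        have "\<exists>y\<in>{(T ^^ q) v | q. True}. y \<in> U" if U: "openin entire_topology U" "h \<in> U" for U
        proof -
          obtain K e where K: "compact K" "0 < e" "compact_nhd h K e \<subseteq> U"
            using U unfolding openin_entire_topology by blast
          obtain r where r: "K \<subseteq> cball 0 r"
            using bounded_subset_ballD[OF compact_imp_bounded[OF K(1)], of 0] ball_subset_cball by blast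
          obtain q where "(T ^^ q) v \<in> compact_nhd h (cball 0 r) e"
            using orbit[of h e r] h K(2) by (auto simp: topspace_entire_topology)
          then have "(T ^^ q) v \<in> U" using r K(3) by (auto simp: compact_nhd_def)
          then show ?thesis by blast
        qed
        then show "h \<in> entire_topology closure_of {(T ^^ q) v | q. True}"
          using h by (auto simp: in_closure_of)
      qed
      moreover have "v \<in> entire_functions" unfolding p(1) by (intro entire_poly_compose u)
      ultimately show ?thesis by (simp add: hypercyclic_vectors_def topspace_entire_topology)
    qed (simp add: p)
  qed
  ultimately show ?thesis unfolding supports_hypercyclic_algebra_def by blast
qed

section \<open>Borel transforms of powers are dense\<close>

text \<open>The \<open>L\<close>-th derivative of \<open>z\<^sup>L p (z / L)\<close>, divided by \<open>L!\<close>, tends to this function as \<open>L\<close> grows,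
  because \<open>(L + j)! / (L! L\<^sup>j)\<close> tends to 1.\<close>

definition borel_transform :: "complex poly \<Rightarrow> complex \<Rightarrow> complex" where
  "borel_transform p z = (\<Sum>j\<le>degree p. coeff p j / fact j * z ^ j)"

lemma borel_transform_eq:
  assumes "degree p \<le> d"
  shows "borel_transform p z = (\<Sum>j\<le>d. coeff p j / fact j * z ^ j)"
  unfolding borel_transform_def
  by (rule sum.mono_neutral_left) (use assms in \<open>auto simp: coeff_eq_0\<close>)

lemma borel_transform_diff: "borel_transform (p - q) z = borel_transform p z - borel_transform q z"
proof -
  define d where "d = max (degree p) (degree q)"
  have "degree (p - q) \<le> d" "degree p \<le> d" "degree q \<le> d"
    by (auto simp: d_def degree_diff_le_max)
  then show ?thesis
    by (simp add: borel_transform_eq[of _ d] sum_subtractf[symmetric] ring_distribs diff_divide_distrib)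
qed

lemma borel_transform_surj: obtains q where "borel_transform q = poly p" "coeff q 0 = coeff p 0"
proof -
  define q where "q = Abs_poly (\<lambda>j. fact j * coeff p j)"
  have *: "coeff q j = fact j * coeff p j" for j
    unfolding q_def by (rule coeff_Abs_poly[of "degree p", THEN fun_cong]) (simp add: coeff_eq_0)
  have "degree q = degree p"
  proof (rule antisym; rule degree_le)
    show "\<forall>i>degree q. coeff p i = 0" using *[of i for i] coeff_eq_0[of q]
      by (metis fact_nonzero mult_eq_0_iff)
  qed (simp add: * coeff_eq_0)
  then have "borel_transform q = poly p"
    by (auto simp: borel_transform_def * poly_altdef)
  with * show ?thesis using that[of q] by simp
qed

lemma higher_deriv_power_at_0:
  "(deriv ^^ i) (\<lambda>z::complex. z ^ k) 0 = (if i = k then fact k else 0)"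
proof -
  have "(deriv ^^ i) (\<lambda>z::complex. (z - 0) ^ k) 0 =
    pochhammer (of_nat (Suc k - i)) i * (0 - 0) ^ (k - i)" by (rule higher_deriv_power)
  moreover have "pochhammer (1::complex) k = fact k" by (simp add: pochhammer_fact)
  ultimately show ?thesis by (auto simp: power_0_left pochhammer_0_left not_less)
qed

lemma higher_deriv_sum_monomials:
  "(deriv ^^ i) (\<lambda>z::complex. \<Sum>j\<in>J. a j * z ^ j) w = (\<Sum>j\<in>J. a j * (deriv ^^ i) (\<lambda>z. z ^ j) w)"
proof -
  have "scaled_deriv i (\<lambda>z. \<Sum>j\<in>J. a j * z ^ j) = (\<lambda>z. \<Sum>j\<in>J. a j * scaled_deriv i (\<lambda>z. z ^ j) z)"
    by (rule continuous_linear_operator_sum[OF continuous_linear_operator_scaled_deriv entire_monomial])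
  from fun_cong[OF this, of w] show ?thesis
    by (simp add: scaled_deriv_def flip: sum_divide_distrib)
qed

lemma norm_coeff_le:
  fixes p :: "complex poly"
  assumes "0 < s" "\<And>w. norm w = s \<Longrightarrow> norm (poly p w) \<le> B"
  shows "norm (coeff p j) \<le> B / s ^ j"
proof -
  have "norm ((deriv ^^ j) (poly p) 0) \<le> fact j * B / s ^ j"
    by (rule Cauchy_inequality) (use assms in \<open>auto intro!: holomorphic_intros continuous_intros\<close>)
  moreover have "(deriv ^^ j) (poly p) 0 = fact j * coeff p j"
  proof -
    have "(deriv ^^ j) (poly p) 0 = (\<Sum>i\<le>degree p. coeff p i * (deriv ^^ j) (\<lambda>z. z ^ i) 0)"
      unfolding poly_altdef[abs_def] by (rule higher_deriv_sum_monomials)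
    also have "\<dots> = (\<Sum>i\<le>degree p. if i = j then fact j * coeff p j else 0)"
      by (intro sum.cong) (auto simp: higher_deriv_power_at_0)
    also have "\<dots> = fact j * coeff p j" by (auto simp: coeff_eq_0)
    finally show ?thesis .
  qed
  ultimately have "fact j * norm (coeff p j) \<le> fact j * (B / s ^ j)" by (simp add: norm_mult)
  then show ?thesis by (rule mult_left_le_imp_le) simp
qed

text \<open>The transform turns smallness on a circle of any radius \<open>s\<close>, however short, into smallness on
  every disc: by Cauchy the coefficients are at most \<open>B / s\<^sup>j\<close>, and the factorials make the series
  converge everywhere.\<close>

lemma borel_transform_bound:
  assumes s: "0 < s" and B: "\<And>w. norm w = s \<Longrightarrow> norm (poly p w) \<le> B" and z: "norm z \<le> r"
  shows "norm (borel_transform p z) \<le> B * exp (r / s)"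
proof -
  have "norm z \<ge> 0" by simp
  with z have r: "0 \<le> r" by linarith
  have "0 \<le> B"
    by (rule order_trans[OF norm_ge_zero B[of "of_real s"]]) (use s in simp)
  have "norm (borel_transform p z) \<le> (\<Sum>j\<le>degree p. B * ((r / s) ^ j / fact j))"
    unfolding borel_transform_def
  proof (rule sum_norm_le)
    fix j
    have "norm (coeff p j / fact j * z ^ j) = norm (coeff p j) * norm z ^ j / fact j"
      by (simp add: norm_mult norm_divide norm_power)
    also have "\<dots> \<le> (B / s ^ j) * r ^ j / fact j"
      using norm_coeff_le[OF s B] z \<open>0 \<le> B\<close> s
      by (intro divide_right_mono mult_mono power_mono) auto
    finally show "norm (coeff p j / fact j * z ^ j) \<le> B * ((r / s) ^ j / fact j)"
      by (simp add: power_divide)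
  qed
  also have "\<dots> = B * (\<Sum>j\<le>degree p. (r / s) ^ j /\<^sub>R fact j)"
    by (simp add: sum_distrib_left divide_inverse mult.commute)
  also have "\<dots> \<le> B * exp (r / s)"
  proof (intro mult_left_mono \<open>0 \<le> B\<close>)
    show "(\<Sum>j\<le>degree p. (r / s) ^ j /\<^sub>R fact j) \<le> exp (r / s)"
      unfolding exp_def using r s
      by (intro sum_le_suminf summable_exp_generic) auto
  qed
  finally show ?thesis .
qed

text \<open>Near a point where \<open>q\<close> does not vanish it has a holomorphic \<open>m\<close>-th root, which Taylor polynomials
  approximate. The good disc depends on \<open>q\<close> and is usually small, which is all that the bound above
  asks for.\<close>

lemma polynomial_root_approximation:
  assumes m: "1 \<le> m" and q0: "coeff q 0 \<noteq> (0::complex)"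
  obtains s where "0 < s"
    "\<And>e. 0 < e \<Longrightarrow> \<exists>p. \<forall>w\<in>cball 0 s. dist (poly (p ^ m) w) (poly q w) < e"
proof -
  define a where "a = coeff q 0"
  have "(\<lambda>w. poly q w / a) \<midarrow>0\<rightarrow> poly q 0 / a" by (intro tendsto_intros) (use q0 in \<open>auto simp: a_def\<close>)
  moreover have "poly q 0 / a = 1" using q0 by (simp add: a_def poly_0_coeff_0)
  ultimately have "\<forall>\<^sub>F w in at 0. dist (poly q w / a) 1 < 1" by (simp add: tendsto_iff)
  then obtain R where R: "0 < R" "\<And>w. w \<noteq> 0 \<Longrightarrow> dist w 0 < R \<Longrightarrow> dist (poly q w / a) 1 < 1"
    by (auto simp: eventually_at)
  have near1: "dist (poly q w / a) 1 < 1" if "w \<in> ball 0 R" for w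
    using R(2)[of w] that q0 by (cases "w = 0") (auto simp: a_def poly_0_coeff_0)
  have slit: "poly q w / a \<notin> \<real>\<^sub>\<le>\<^sub>0" if "w \<in> ball 0 R" for w
  proof
    assume "poly q w / a \<in> \<real>\<^sub>\<le>\<^sub>0"
    then have "Re (poly q w / a) \<le> 0" by (auto simp: complex_nonpos_Reals_iff)
    moreover have "\<bar>Re (poly q w / a - 1)\<bar> < 1"
      using near1[OF that] abs_Re_le_cmod[of "poly q w / a - 1"] by (simp only: dist_norm)
    ultimately show False by simp
  qed
  obtain c where c: "c ^ m = a"
  proof
    show "exp (Ln a / of_nat m) ^ m = a" using m q0 by (simp add: a_def flip: exp_of_nat_mult)
  qed
  define F where "F = (\<lambda>w. c * exp (Ln (poly q w / a) / of_nat m))"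
  have F: "F holomorphic_on ball 0 R"
    unfolding F_def using slit m q0 by (intro holomorphic_intros) (auto simp: a_def)
  have Fm: "F w ^ m = poly q w" if "w \<in> ball 0 R" for w
  proof -
    have "poly q w / a \<noteq> 0" using slit[OF that] by auto
    then show ?thesis using m c q0
      by (simp add: F_def power_mult_distrib a_def flip: exp_of_nat_mult)
  qed
  show ?thesis
  proof (rule that[of "R / 2"])
    fix e :: real assume e: "0 < e"
    have sub: "cball 0 (R/2) \<subseteq> ball (0::complex) R" using R by auto
    have "compact (F ` cball 0 (R/2))"
      by (intro compact_continuous_image holomorphic_on_imp_continuous_on holomorphic_on_subset[OF F sub])
         simp
    then obtain d where d: "0 < d"
      "\<And>v z. z \<in> cball 0 (R/2) \<Longrightarrow> dist (v z) (F z) < d \<Longrightarrow> dist (v z ^ m) (F z ^ m) < e"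
      using power_perturbation[of F "cball 0 (R/2)" e m] e by metis
    obtain p where "\<And>w. w \<in> cball 0 (R/2) \<Longrightarrow> dist (poly p w) (F w) < d"
      using polynomial_approximation_on_ball[OF F, of "R/2" d] R d(1) by auto
    then have "dist (poly (p ^ m) w) (poly q w) < e" if "w \<in> cball 0 (R/2)" for w
      using d(2)[of w "poly p"] that sub Fm[of w] by auto
    then show "\<exists>p. \<forall>w\<in>cball 0 (R/2). dist (poly (p ^ m) w) (poly q w) < e" by blast
  qed (use R in simp)
qed

text \<open>A polynomial \<open>P\<close> close to \<open>f\<close> with nonzero constant term is the Borel transform of some \<open>q\<close>; a
  polynomial whose \<open>m\<close>-th power is close to \<open>q\<close> near the origin then has the required transform.\<close>

lemma borel_transforms_of_powers_dense:
  assumes m: "1 \<le> m" and f: "f \<in> entire_functions" and e: "0 < e"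
  obtains p where "borel_transform (p ^ m) \<in> compact_nhd f (cball 0 r) e"
proof -
  obtain p0 where p0: "poly p0 \<in> compact_nhd f (cball 0 r) (e/3)"
    using polynomials_dense[OF f, of "e/3" r] e by auto
  obtain b :: complex where b: "norm b < e/3" "coeff p0 0 + b \<noteq> 0"
  proof (cases "coeff p0 0 = 0")
    case True
    then show ?thesis using that[of "of_real (e/4)"] e by simp
  next
    case False
    then show ?thesis using that[of 0] e by simp
  qed
  obtain q where q: "borel_transform q = poly (p0 + [:b:])" "coeff q 0 = coeff (p0 + [:b:]) 0"
    by (rule borel_transform_surj)
  have "coeff q 0 \<noteq> 0" using q(2) b(2) by simp
  then obtain s where s: "0 < s"
    "\<And>e. 0 < e \<Longrightarrow> \<exists>p. \<forall>w\<in>cball 0 s. dist (poly (p ^ m) w) (poly q w) < e"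
    using polynomial_root_approximation[OF m] by blast
  define d where "d = e / (3 * exp (r / s))"
  have d: "0 < d" "d * exp (r/s) = e/3" using e by (auto simp: d_def)
  obtain p where p: "\<And>w. w \<in> cball 0 s \<Longrightarrow> dist (poly (p ^ m) w) (poly q w) < d"
    using s(2)[OF d(1)] by blast
  have "dist (borel_transform (p ^ m) z) (f z) < e" if z: "z \<in> cball 0 r" for z
  proof -
    have "norm (borel_transform (p ^ m - q) z) \<le> d * exp (r / s)"
      by (rule borel_transform_bound[OF s(1)]) (use p z in \<open>auto simp: dist_norm less_imp_le\<close>)
    then have "norm (borel_transform (p ^ m) z - poly (p0 + [:b:]) z) \<le> e / 3"
      by (simp add: borel_transform_diff q d)
    moreover have "norm (poly p0 z - f z) < e/3"
      using p0 z by (auto simp: compact_nhd_def dist_norm)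
    moreover have "borel_transform (p ^ m) z - f z =
      (borel_transform (p ^ m) z - poly (p0 + [:b:]) z) + (b + (poly p0 z - f z))" by simp
    moreover have "norm \<dots> \<le> norm (borel_transform (p ^ m) z - poly (p0 + [:b:]) z)
        + (norm b + norm (poly p0 z - f z))"
      by (intro order_trans[OF norm_triangle_ineq] add_left_mono norm_triangle_ineq)
    ultimately show ?thesis using b(1) by (simp add: dist_norm)
  qed
  moreover have "borel_transform (p ^ m) \<in> entire_functions"
    unfolding borel_transform_def[abs_def] by (intro entire_sum entire_mult entire_const entire_monomial)
  ultimately show ?thesis using that[of p] by (simp add: compact_nhd_def)
qed

section \<open>Factorial estimates\<close>

text \<open>A single term of the exponential series. Together with the next lemma it pins down
  \<open>k!\<close> up to a factor \<open>e k\<close>, a polynomial loss that a geometric gain will absorb.\<close>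

lemma power_self_le_fact_exp: "real k ^ k \<le> fact k * exp (real k)"
proof -
  have "real k ^ k /\<^sub>R fact k \<le> (\<Sum>j. real k ^ j /\<^sub>R fact j)"
    using sum_le_suminf[OF summable_exp_generic[of "real k"], of "{k}"] by simp
  then show ?thesis by (simp add: exp_def field_simps)
qed

text \<open>The induction step is the inequality \<open>e \<le> (1 + 1 / k)\<^bsup>k + 1\<^esup>\<close>.\<close>

lemma fact_le_power_self: "1 \<le> k \<Longrightarrow> fact k \<le> real k * (real k ^ k * exp (1 - real k))"
proof (induction k rule: nat_induct_at_least)
  case (Suc k)
  define x where "x = real k"
  have x: "0 < x" using Suc by (simp add: x_def)
  have "x / (x + 1) \<le> exp (- (1 / (x + 1)))"
    using exp_ge_add_one_self[of "- (1 / (x + 1))"] x by (simp add: field_simps)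
  then have "exp (1 / (x + 1)) \<le> (x + 1) / x" using x by (simp add: exp_minus field_simps)
  then have "exp (1 / (x + 1)) ^ Suc k \<le> ((x + 1) / x) ^ Suc k" by (intro power_mono) auto
  moreover have "exp (1 / (x + 1)) ^ Suc k = exp 1"
    using x by (simp add: x_def add.commute flip: exp_of_nat_mult del: power_Suc)
  ultimately have "exp 1 \<le> (x + 1) ^ Suc k / x ^ Suc k" by (simp only: power_divide)
  then have *: "exp 1 * (x * x ^ k) \<le> (x + 1) ^ Suc k" using x by (simp add: field_simps)
  have "fact (Suc k) \<le> (x + 1) * (x * (x ^ k * exp (1 - x)))"
    using Suc.IH by (simp add: x_def add.commute)
  also have "\<dots> = (x + 1) * (exp 1 * (x * x ^ k) * exp (- x))"
    by (simp add: exp_diff exp_minus field_simps)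
  also have "\<dots> \<le> (x + 1) * ((x + 1) ^ Suc k * exp (- x))"
    using x * by (intro mult_left_mono mult_right_mono) auto
  finally show ?case by (simp add: x_def add.commute)
qed simp

lemma geometric_beats_power:
  fixes \<theta> :: real
  assumes "0 \<le> \<theta>" "\<theta> < 1"
  shows "(\<lambda>x. \<theta> ^ x * (real (x + j) ^ Suc j)) \<longlonglongrightarrow> 0"
proof -
  define \<phi> where "\<phi> = root (Suc j) \<theta>"
  have \<phi>: "0 \<le> \<phi>" "\<phi> < 1" "\<phi> ^ Suc j = \<theta>"
    using assms by (auto simp: \<phi>_def simp del: power_Suc intro: real_root_pow_pos2)
  have "(\<lambda>x. real x * \<phi> ^ x + real j * \<phi> ^ x) \<longlonglongrightarrow> 0 + real j * 0"
    using \<phi> powser_times_n_limit_0[of \<phi>] by (intro tendsto_intros LIMSEQ_power_zero) auto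
  then have "(\<lambda>x. (real (x + j) * \<phi> ^ x) ^ Suc j) \<longlonglongrightarrow> 0 ^ Suc j"
    by (intro tendsto_power) (simp add: algebra_simps)
  also have "(\<lambda>x. (real (x + j) * \<phi> ^ x) ^ Suc j) = (\<lambda>x. \<theta> ^ x * (real (x + j) ^ Suc j))"
    by (simp only: power_mult_distrib \<phi>(3)[symmetric] power_mult[symmetric] mult.commute)
  finally show ?thesis by simp
qed

lemma fact_add_le: "fact (x + j) \<le> (fact x * real (x + j) ^ j :: real)"
proof (induction j)
  case (Suc j)
  have "fact (x + Suc j) = real (x + Suc j) * fact (x + j)" by simp
  also have "\<dots> \<le> real (x + Suc j) * (fact x * real (x + j) ^ j)"
    by (intro mult_left_mono Suc) simp
  also have "\<dots> \<le> real (x + Suc j) * (fact x * real (x + Suc j) ^ j)"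
    by (intro mult_left_mono power_mono) auto
  finally show ?case by (simp add: mult_ac)
qed simp

lemma fact_quotient_tendsto: "(\<lambda>L. fact (L + j) / (fact L * real L ^ j)) \<longlonglongrightarrow> 1"
proof (induction j)
  case (Suc j)
  have "(\<lambda>L. 1 + real (Suc j) / real L) \<longlonglongrightarrow> 1 + 0"
    by (intro tendsto_add tendsto_const lim_const_over_n)
  then have "(\<lambda>L. fact (L + j) / (fact L * real L ^ j) * (1 + real (Suc j) / real L)) \<longlonglongrightarrow> 1 * 1"
    by (intro tendsto_mult Suc) simp
  moreover have "\<forall>\<^sub>F L in sequentially. fact (L + j) / (fact L * real L ^ j) * (1 + real (Suc j) / real L)
     = fact (L + Suc j) / (fact L * real L ^ Suc j)"
    using eventually_gt_at_top[of 0]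
  proof eventually_elim
    fix L :: nat assume "0 < L"
    then have "1 + real (Suc j) / real L = real (L + Suc j) / real L" by (simp add: field_simps)
    then show "fact (L + j) / (fact L * real L ^ j) * (1 + real (Suc j) / real L)
      = fact (L + Suc j) / (fact L * real L ^ Suc j)" by (simp add: mult_ac)
  qed
  ultimately show ?case by (simp add: tendsto_cong)
qed simp

section \<open>Truncations, derivatives and monomials\<close>

lemma pochhammer_eq_fact_quotient: "i \<le> k \<Longrightarrow> pochhammer (of_nat (Suc k - i)) i = (fact k / fact (k - i) :: complex)"
proof -
  assume i: "i \<le> k"
  have "pochhammer (1::complex) k = pochhammer 1 (k - i) * pochhammer (1 + of_nat (k - i)) (k - (k - i))"
    by (rule pochhammer_product) simp
  with i show ?thesis by (simp add: pochhammer_fact[symmetric] Suc_diff_le field_simps)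
qed

lemma scaled_deriv_monomial:
  "scaled_deriv i (\<lambda>z. z ^ k) =
     (if i \<le> k then (\<lambda>z. fact k / (fact (k - i) * fact i) * z ^ (k - i)) else (\<lambda>z. 0))"
proof
  fix w
  have "(deriv ^^ i) (\<lambda>z::complex. (z - 0) ^ k) w =
    pochhammer (of_nat (Suc k - i)) i * (w - 0) ^ (k - i)" by (rule higher_deriv_power)
  then show "scaled_deriv i (\<lambda>z. z ^ k) w =
     (if i \<le> k then (\<lambda>z. fact k / (fact (k - i) * fact i) * z ^ (k - i)) else (\<lambda>z. 0)) w"
    by (auto simp: scaled_deriv_def pochhammer_eq_fact_quotient pochhammer_0_left not_le simp del: of_nat_diff)
qed

lemma taylor_truncation_monomial:
  "taylor_truncation n (\<lambda>z. z ^ k) = (if k \<le> n then (\<lambda>z. z ^ k) else (\<lambda>z. 0))"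
proof
  fix w
  have "taylor_truncation n (\<lambda>z. z ^ k) w = (\<Sum>j\<le>n. if j = k then w ^ k else 0)"
    unfolding taylor_truncation_def by (intro sum.cong) (auto simp: higher_deriv_power_at_0)
  then show "taylor_truncation n (\<lambda>z. z ^ k) w = (if k \<le> n then (\<lambda>z. z ^ k) else (\<lambda>z. 0)) w"
    by auto
qed

lemma scaled_deriv_taylor_truncation: "n < i \<Longrightarrow> scaled_deriv i (taylor_truncation n f) = (\<lambda>z. 0)"
  unfolding taylor_truncation_def
  by (subst continuous_linear_operator_sum[OF continuous_linear_operator_scaled_deriv entire_monomial])
     (simp add: scaled_deriv_monomial)

section \<open>Iterates of the perturbed operator on monomials\<close>

locale truncated_plus_shift =
  fixes B :: "(complex \<Rightarrow> complex) \<Rightarrow> (complex \<Rightarrow> complex)" and n :: nat and \<delta> :: real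
  assumes B: "continuous_linear_operator B"
    and trunc: "\<And>f. f \<in> entire_functions \<Longrightarrow> B f = taylor_truncation n (B (taylor_truncation n f))"
    and stable: "\<And>j::nat. limitin entire_topology (\<lambda>m. (B ^^ m) (\<lambda>z. z ^ j)) (\<lambda>z. 0) sequentially"
    and \<delta>: "0 < \<delta>"
begin

text \<open>With \<open>c = \<delta> / N!\<close> the derivative part multiplies \<open>z\<^bsup>N + k\<^esup>\<close> by \<open>c * (N + k)! / k!\<close> and lowers
  the exponent by \<open>N\<close>; these quotients telescope along orbits.\<close>

definition N :: nat where "N = n + 1"
definition c :: real where "c = \<delta> / fact N"
definition A :: "(complex \<Rightarrow> complex) \<Rightarrow> (complex \<Rightarrow> complex)" where
  "A = (\<lambda>f z. B f z + of_real \<delta> * scaled_deriv N f z)"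

lemma N_pos: "0 < N" by (simp add: N_def)
lemma c_pos: "0 < c" using \<delta> by (simp add: c_def)

lemma A_operator: "continuous_linear_operator A"
  unfolding A_def by (intro continuous_linear_operator_add_scaled B continuous_linear_operator_scaled_deriv)

lemmas A_funpow = continuous_linear_operator_funpow[OF A_operator]
lemmas A_funpowD = continuous_linear_operatorD[OF A_funpow]

lemma B_monomial_high: "n < k \<Longrightarrow> B (\<lambda>z. z ^ k) = (\<lambda>z. 0)"
proof -
  assume k: "n < k"
  have "B (\<lambda>z. 0) = (\<lambda>z. 0)"
    using continuous_linear_operatorD(3)[OF B entire_const[of 0], of 0] by simp
  moreover have "taylor_truncation n (\<lambda>z. 0) = (\<lambda>z. 0)"
    unfolding taylor_truncation_def by (simp add: higher_deriv_const)
  ultimately show ?thesis using trunc[OF entire_monomial[of k]] k by (simp add: taylor_truncation_monomial)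
qed

text \<open>After one step the orbit of \<open>z\<^sup>s\<close> under \<open>B\<close> consists of polynomials of degree at most \<open>n\<close>, which the
  derivative of order \<open>n + 1\<close> kills.\<close>

lemma A_funpow_monomial_low:
  assumes "s < N"
  shows "(A ^^ i) (\<lambda>z. z ^ s) = (B ^^ i) (\<lambda>z. z ^ s)"
proof (induction i)
  case (Suc i)
  have ent: "(B ^^ i) (\<lambda>z. z ^ s) \<in> entire_functions" for i
    by (rule continuous_linear_operatorD(1)[OF continuous_linear_operator_funpow[OF B] entire_monomial])
  have "scaled_deriv N ((B ^^ i) (\<lambda>z. z ^ s)) = (\<lambda>z. 0)"
  proof (cases i)
    case 0
    then show ?thesis using assms by (simp add: scaled_deriv_monomial)
  next
    case (Suc k)
    have "(B ^^ i) (\<lambda>z. z ^ s) = taylor_truncation n (B (taylor_truncation n ((B ^^ k) (\<lambda>z. z ^ s))))"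
      using trunc[OF ent[of k]] by (simp add: Suc)
    then show ?thesis by (simp add: scaled_deriv_taylor_truncation N_def)
  qed
  moreover have "A ((B ^^ i) (\<lambda>z. z ^ s)) =
      (\<lambda>z. B ((B ^^ i) (\<lambda>z. z ^ s)) z + of_real \<delta> * scaled_deriv N ((B ^^ i) (\<lambda>z. z ^ s)) z)"
    by (simp add: A_def)
  ultimately show ?case by (simp add: Suc)
qed simp

lemma A_monomial: "A (\<lambda>z. z ^ (N + k)) = (\<lambda>z. of_real (c * fact (N + k) / fact k) * z ^ k)"
proof -
  have "n < N + k" by (simp add: N_def)
  then show ?thesis
    by (simp add: A_def B_monomial_high scaled_deriv_monomial c_def mult_ac)
qed

lemma A_funpow_monomial_shift:
  "(A ^^ r) (\<lambda>z. z ^ (N * r + t)) = (\<lambda>z. of_real (c ^ r * fact (N * r + t) / fact t) * z ^ t)"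
proof (induction r)
  case (Suc r)
  have "A (\<lambda>z. z ^ (N * Suc r + t)) =
    (\<lambda>z. of_real (c * fact (N * Suc r + t) / fact (N * r + t)) * z ^ (N * r + t))"
    using A_monomial[of "N * r + t"] by (simp add: add.assoc)
  then have "(A ^^ Suc r) (\<lambda>z. z ^ (N * Suc r + t)) =
    (\<lambda>z. of_real (c * fact (N * Suc r + t) / fact (N * r + t)) * (A ^^ r) (\<lambda>z. z ^ (N * r + t)) z)"
    unfolding funpow_Suc_right o_def by (simp only: A_funpowD(3)[OF entire_monomial])
  then show ?case unfolding Suc by (simp add: mult_ac)
qed simp

text \<open>A monomial is first lowered \<open>k div N\<close> times by the derivative part; from then on it has degree
  at most \<open>n\<close> and only \<open>B\<close> acts.\<close>

lemma A_funpow_monomial: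
  assumes "k div N \<le> q"
  shows "(A ^^ q) (\<lambda>z. z ^ k) =
    (\<lambda>z. of_real (c ^ (k div N) * fact k / fact (k mod N)) * (B ^^ (q - k div N)) (\<lambda>z. z ^ (k mod N)) z)"
proof -
  have "(A ^^ q) (\<lambda>z. z ^ k) = (A ^^ (q - k div N)) ((A ^^ (k div N)) (\<lambda>z. z ^ (N * (k div N) + k mod N)))"
    using assms funpow_add[of "q - k div N" "k div N" A] by (simp add: o_def fun_eq_iff)
  then show ?thesis unfolding A_funpow_monomial_shift A_funpowD(3)[OF entire_monomial]
    using N_pos by (simp add: A_funpow_monomial_low)
qed

lemma B_funpow_limit: "uniform_limit (cball 0 r) (\<lambda>m. (B ^^ m) (\<lambda>z. z ^ j)) (\<lambda>_. 0) sequentially"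
  using stable[of j] compact_cball
  unfolding limitin_entire_topology[OF
    continuous_linear_operatorD(1)[OF continuous_linear_operator_funpow[OF B] entire_monomial]]
  by simp

lemma A_funpow_limit: "uniform_limit (cball 0 r) (\<lambda>q. (A ^^ q) (\<lambda>z. z ^ k)) (\<lambda>_. 0) sequentially"
proof -
  have "uniform_limit (cball 0 r) (\<lambda>m z. of_real (c ^ (k div N) * fact k / fact (k mod N)) *
      (B ^^ m) (\<lambda>z. z ^ (k mod N)) z) (\<lambda>z. of_real (c ^ (k div N) * fact k / fact (k mod N)) * 0) sequentially"
    by (intro uniform_limit_cmult B_funpow_limit)
  then have "uniform_limit (cball 0 r) (\<lambda>m. (A ^^ (m + k div N)) (\<lambda>z. z ^ k)) (\<lambda>_. 0) sequentially"
    by (simp add: A_funpow_monomial)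
  then show ?thesis
    unfolding uniform_limit_iff by (subst (asm) eventually_sequentially_seg) auto
qed

lemma B_orbits_bounded:
  obtains C where "0 \<le> C"
    "\<And>s i (z::complex). s < N \<Longrightarrow> z \<in> cball 0 r \<Longrightarrow> norm ((B ^^ i) (\<lambda>z. z ^ s) z) \<le> C"
proof -
  have "\<exists>C. \<forall>i. \<forall>z\<in>cball 0 r. norm ((B ^^ i) (\<lambda>z. z ^ s) z) \<le> C" for s
  proof -
    define g where "g = (\<lambda>i. (B ^^ i) (\<lambda>z. z ^ s))"
    have "\<forall>\<^sub>F i in sequentially. \<forall>z\<in>cball 0 r. dist (g i z) 0 < 1"
      unfolding g_def by (rule uniform_limitD[OF B_funpow_limit zero_less_one])
    then obtain k where "\<forall>i\<ge>k. \<forall>z\<in>cball 0 r. dist (g i z) 0 < 1"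
      unfolding eventually_sequentially by blast
    then have k: "norm (g i z) < 1" if "k \<le> i" "z \<in> cball 0 r" for i z
      using that by simp
    have "\<exists>M. \<forall>z\<in>cball 0 r. norm (g i z) \<le> M" for i
    proof -
      have "g i \<in> entire_functions" unfolding g_def
        by (rule continuous_linear_operatorD(1)[OF continuous_linear_operator_funpow[OF B] entire_monomial])
      then have "compact (g i ` cball 0 r)"
        by (intro compact_continuous_image entire_continuous_on compact_cball)
      then have "bounded (g i ` cball 0 r)" by (rule compact_imp_bounded)
      then show ?thesis by (simp add: bounded_iff)
    qed
    then obtain M where M: "\<And>i z. z \<in> cball 0 r \<Longrightarrow> norm (g i z) \<le> M i" by metis
    have "norm (g i z) \<le> 1 + (\<Sum>i<k. \<bar>M i\<bar>)" if "z \<in> cball 0 r" for i z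
    proof (cases "i < k")
      case True
      have "norm (g i z) \<le> \<bar>M i\<bar>" using M[OF that, of i] by simp
      also have "\<dots> \<le> (\<Sum>i<k. \<bar>M i\<bar>)" using True by (intro member_le_sum) auto
      finally show ?thesis by simp
    next
      case False
      then have "norm (g i z) < 1" using k that by simp
      moreover have "0 \<le> (\<Sum>i<k. \<bar>M i\<bar>)" by (simp add: sum_nonneg)
      ultimately show ?thesis by linarith
    qed
    then show ?thesis unfolding g_def by blast
  qed
  then obtain C where C: "\<And>s i z. z \<in> cball 0 r \<Longrightarrow> norm ((B ^^ i) (\<lambda>z. z ^ s) z) \<le> C s" by metis
  show ?thesis
  proof (rule that[of "\<Sum>s<N. \<bar>C s\<bar>"])
    fix s i and z :: complex assume *: "s < N" "z \<in> cball 0 r"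
    have "norm ((B ^^ i) (\<lambda>z. z ^ s) z) \<le> \<bar>C s\<bar>" using C[OF *(2), of i s] by simp
    also have "\<dots> \<le> (\<Sum>s<N. \<bar>C s\<bar>)" using * by (intro member_le_sum) auto
    finally show "norm ((B ^^ i) (\<lambda>z. z ^ s) z) \<le> (\<Sum>s<N. \<bar>C s\<bar>)" .
  qed (simp add: sum_nonneg)
qed

text \<open>A monomial that has been lowered to degree at most \<open>n\<close> keeps the accumulated factor
  \<open>c\<^bsup>k div N\<^esup> k!\<close>, and the orbits of \<open>B\<close> add no more than a constant to it.\<close>

lemma A_funpow_monomial_bound:
  obtains C where "0 \<le> C" "\<And>q k (z::complex). k < N * q \<Longrightarrow> z \<in> cball 0 r \<Longrightarrow>
    norm ((A ^^ q) (\<lambda>z. z ^ k) z) \<le> C * (c ^ (k div N) * fact k)"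
proof -
  obtain C where C: "0 \<le> C"
    "\<And>s i (z::complex). s < N \<Longrightarrow> z \<in> cball 0 r \<Longrightarrow> norm ((B ^^ i) (\<lambda>z. z ^ s) z) \<le> C"
    using B_orbits_bounded by blast
  show ?thesis
  proof (rule that[OF C(1)])
    fix q k and z :: complex assume k: "k < N * q" and z: "z \<in> cball 0 r"
    have "k div N \<le> q" using k N_pos by (simp add: less_mult_imp_div_less mult.commute less_imp_le)
    then have "norm ((A ^^ q) (\<lambda>z. z ^ k) z) =
      (c ^ (k div N) * fact k / fact (k mod N)) * norm ((B ^^ (q - k div N)) (\<lambda>z. z ^ (k mod N)) z)"
      using c_pos by (simp add: A_funpow_monomial norm_mult norm_divide norm_power)
    also have "\<dots> \<le> (c ^ (k div N) * fact k / 1) * C"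
      using c_pos N_pos C z by (intro mult_mono divide_left_mono) (auto simp: fact_ge_1)
    finally show "norm ((A ^^ q) (\<lambda>z. z ^ k) z) \<le> C * (c ^ (k div N) * fact k)" by (simp add: mult_ac)
  qed
qed

section \<open>Powers of a small high-degree perturbation\<close>

text \<open>The size of the perturbation is chosen such that the \<open>m\<close>-th power of
  \<open>height m \<kappa> * z\<^bsup>N * \<kappa>\<^esup>\<close>, of degree \<open>N * (m * \<kappa>)\<close>, is mapped to the constant 1 by
  \<open>m * \<kappa>\<close> iterations. Taking the number of iterations to be a multiple of \<open>m\<close> makes the exponents
  exact.\<close>

definition height :: "nat \<Rightarrow> nat \<Rightarrow> real" where
  "height m \<kappa> = root m (1 / (c ^ (m * \<kappa>) * fact (N * (m * \<kappa>))))"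

lemma height_nonneg: "0 \<le> height m \<kappa>"
  using c_pos by (simp add: height_def real_root_ge_zero)

lemma height_power: "1 \<le> m \<Longrightarrow> height m \<kappa> ^ m = 1 / (c ^ (m * \<kappa>) * fact (N * (m * \<kappa>)))"
  unfolding height_def using c_pos by (intro real_root_pow_pos2) auto

lemma height_le:
  assumes "1 \<le> m" "1 \<le> \<kappa>"
  shows "height m \<kappa> * c ^ \<kappa> \<le> (exp 1 / real (N * (m * \<kappa>))) ^ (N * \<kappa>)"
proof -
  define L where "L = N * (m * \<kappa>)"
  have L: "0 < L" using assms N_pos by (simp add: L_def)
  have "(height m \<kappa> * c ^ \<kappa>) ^ m = 1 / fact L"
    using c_pos by (simp add: power_mult_distrib height_power[OF assms(1)] L_def mult.commute[of \<kappa>] flip: power_mult)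
  also have "\<dots> \<le> exp (real L) / real L ^ L"
    using power_self_le_fact_exp[of L] L by (simp add: field_simps)
  also have "\<dots> = (exp 1 / real L) ^ L" by (simp add: power_divide flip: exp_of_nat_mult)
  also have "\<dots> = ((exp 1 / real L) ^ (N * \<kappa>)) ^ m"
    by (simp add: L_def mult_ac flip: power_mult)
  finally show ?thesis unfolding L_def[symmetric]
    using c_pos height_nonneg assms(1) by (subst (asm) power_mono_iff) auto
qed

text \<open>The heart of the estimate. With \<open>x = N * \<kappa> * l\<close> and \<open>L = N * m * \<kappa>\<close> the powers of \<open>c\<close> cancel up to a
  constant, and what remains is about \<open>x! / (L!)\<^bsup>l / m\<^esup>\<close>, by Stirling about
  \<open>(x / L)\<^sup>x = (l / m)\<^sup>x\<close>, up to a polynomial in \<open>x\<close>. Since \<open>l < m\<close> this decays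
  geometrically.\<close>

lemma scaled_monomial_coefficient_tendsto:
  assumes l: "1 \<le> l" "l < m"
  shows "(\<lambda>\<kappa>. height m \<kappa> ^ l * (c ^ ((N * \<kappa> * l + j) div N) * fact (N * \<kappa> * l + j))) \<longlonglongrightarrow> 0"
proof -
  define \<theta> where "\<theta> = real l / real m"
  have \<theta>: "0 \<le> \<theta>" "\<theta> < 1" using l by (auto simp: \<theta>_def)
  define M where "M = c ^ (j div N) * exp 1"
  have bound: "height m \<kappa> ^ l * (c ^ ((N * \<kappa> * l + j) div N) * fact (N * \<kappa> * l + j))
      \<le> M * (\<theta> ^ (N * \<kappa> * l) * real (N * \<kappa> * l + j) ^ Suc j)" if \<kappa>: "1 \<le> \<kappa>" for \<kappa>
  proof -
    define x where "x = N * \<kappa> * l"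
    define L where "L = N * (m * \<kappa>)"
    have x: "1 \<le> x" using \<kappa> l N_pos by (simp add: x_def Suc_le_eq)
    have L: "0 < L" using \<kappa> l N_pos by (simp add: L_def)
    have xL: "real x / real L = \<theta>" using \<kappa> N_pos l by (simp add: x_def L_def \<theta>_def)
    have "(x + j) div N = \<kappa> * l + j div N"
      using N_pos by (simp add: x_def mult.assoc)
    then have "height m \<kappa> ^ l * c ^ ((x + j) div N) = c ^ (j div N) * (height m \<kappa> * c ^ \<kappa>) ^ l"
      by (simp add: power_add power_mult_distrib power_mult)
    also have "\<dots> \<le> c ^ (j div N) * ((exp 1 / real L) ^ (N * \<kappa>)) ^ l"
      using height_le[of m \<kappa>] \<kappa> l c_pos height_nonneg by (intro mult_left_mono power_mono) (auto simp: L_def)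
    also have "\<dots> = c ^ (j div N) * (exp 1 / real L) ^ x" by (simp add: x_def flip: power_mult)
    finally have 1: "height m \<kappa> ^ l * c ^ ((x + j) div N) \<le> c ^ (j div N) * (exp 1 / real L) ^ x" .
    have "fact (x + j) \<le> fact x * real (x + j) ^ j" by (rule fact_add_le)
    also have "\<dots> \<le> (real x * (real x ^ x * exp (1 - real x))) * real (x + j) ^ j"
      by (intro mult_right_mono fact_le_power_self x) simp
    also have "\<dots> \<le> (real (x + j) * (real x ^ x * exp (1 - real x))) * real (x + j) ^ j"
      by (intro mult_right_mono) auto
    finally have 2: "fact (x + j) \<le> (real x ^ x * exp (1 - real x)) * real (x + j) ^ Suc j"
      by (simp add: mult_ac)
    have "height m \<kappa> ^ l * (c ^ ((x + j) div N) * fact (x + j)) =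
        (height m \<kappa> ^ l * c ^ ((x + j) div N)) * fact (x + j)" by (rule mult.assoc[symmetric])
    also have "\<dots> \<le> (c ^ (j div N) * (exp 1 / real L) ^ x) * ((real x ^ x * exp (1 - real x)) * real (x + j) ^ Suc j)"
      by (rule mult_mono[OF 1 2]) (use c_pos in auto)
    also have "\<dots> = M * ((real x / real L) ^ x * real (x + j) ^ Suc j)"
    proof -
      have "exp (real x) * exp (1 - real x) = exp 1" by (simp flip: exp_add)
      then have "(exp 1 / real L) ^ x * (real x ^ x * exp (1 - real x)) = exp 1 * (real x / real L) ^ x"
        by (simp add: power_divide flip: exp_of_nat_mult)
      moreover have "(c ^ (j div N) * (exp 1 / real L) ^ x) * ((real x ^ x * exp (1 - real x)) * real (x + j) ^ Suc j)
          = c ^ (j div N) * real (x + j) ^ Suc j * ((exp 1 / real L) ^ x * (real x ^ x * exp (1 - real x)))"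
        by (simp only: mult_ac)
      ultimately show ?thesis by (simp only: M_def) (simp only: mult_ac)
    qed
    finally show ?thesis unfolding xL by (simp add: x_def)
  qed
  have "filterlim (\<lambda>\<kappa>. N * \<kappa> * l) at_top sequentially"
  proof (rule filterlim_at_top_mono[OF filterlim_ident])
    show "\<forall>\<^sub>F \<kappa> in sequentially. \<kappa> \<le> N * \<kappa> * l"
      using N_pos l(1) by (intro always_eventually allI) (simp add: mult_ac)
  qed
  then have "(\<lambda>\<kappa>. M * (\<theta> ^ (N * \<kappa> * l) * real (N * \<kappa> * l + j) ^ Suc j)) \<longlonglongrightarrow> M * 0"
    by (intro tendsto_mult tendsto_const filterlim_compose[OF geometric_beats_power[OF \<theta>]])
  then have lim: "(\<lambda>\<kappa>. M * (\<theta> ^ (N * \<kappa> * l) * real (N * \<kappa> * l + j) ^ Suc j)) \<longlonglongrightarrow> 0" by simp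
  show ?thesis
  proof (rule tendsto_sandwich[OF _ _ tendsto_const lim])
    show "\<forall>\<^sub>F \<kappa> in sequentially. 0 \<le> height m \<kappa> ^ l * (c ^ ((N * \<kappa> * l + j) div N) * fact (N * \<kappa> * l + j))"
      using c_pos height_nonneg by (intro always_eventually allI) simp
    show "\<forall>\<^sub>F \<kappa> in sequentially. height m \<kappa> ^ l * (c ^ ((N * \<kappa> * l + j) div N) * fact (N * \<kappa> * l + j))
      \<le> M * (\<theta> ^ (N * \<kappa> * l) * real (N * \<kappa> * l + j) ^ Suc j)"
      using eventually_ge_at_top[of 1] by eventually_elim (rule bound)
  qed
qed

text \<open>For \<open>l = 0\<close> the monomial is fixed and its orbit tends to zero because that of \<open>B\<close> does. For
  \<open>0 < l < m\<close> its degree grows with \<open>\<kappa>\<close> but stays below \<open>N * (m * \<kappa>)\<close>, so after \<open>m * \<kappa>\<close> steps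
  only the accumulated factor matters.\<close>

lemma scaled_monomial_orbit_limit:
  assumes "l < m"
  shows "uniform_limit (cball 0 r)
    (\<lambda>\<kappa> z. of_real (height m \<kappa> ^ l) * (A ^^ (m * \<kappa>)) (\<lambda>z. z ^ (N * \<kappa> * l + j)) z) (\<lambda>_. 0) sequentially"
proof (cases "l = 0")
  case True
  have "filterlim (\<lambda>\<kappa>. m * \<kappa>) at_top sequentially"
    using assms by (intro filterlim_at_top_mono[OF filterlim_ident] always_eventually allI) simp
  then show ?thesis
    using filterlim_compose[OF A_funpow_limit[where r=r and k=j], of "\<lambda>\<kappa>. m * \<kappa>"] True
    by simp
next
  case False
  obtain C where C: "0 \<le> C" "\<And>q k (z::complex). k < N * q \<Longrightarrow> z \<in> cball 0 r \<Longrightarrow>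
    norm ((A ^^ q) (\<lambda>z. z ^ k) z) \<le> C * (c ^ (k div N) * fact k)"
    using A_funpow_monomial_bound by blast
  let ?a = "\<lambda>\<kappa>. height m \<kappa> ^ l * (c ^ ((N * \<kappa> * l + j) div N) * fact (N * \<kappa> * l + j))"
  have a: "(\<lambda>\<kappa>. C * ?a \<kappa>) \<longlonglongrightarrow> C * 0"
    by (intro tendsto_mult tendsto_const scaled_monomial_coefficient_tendsto) (use False assms in auto)
  have "\<forall>\<^sub>F \<kappa> in sequentially. \<forall>z\<in>cball 0 r.
    norm (of_real (height m \<kappa> ^ l) * (A ^^ (m * \<kappa>)) (\<lambda>z. z ^ (N * \<kappa> * l + j)) z) \<le> C * ?a \<kappa>"
  proof (rule eventually_mono[OF eventually_gt_at_top[of j]], rule ballI)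
    fix \<kappa> and z :: complex assume \<kappa>: "j < \<kappa>" and z: "z \<in> cball 0 r"
    have "j < N * \<kappa>" using \<kappa> N_pos by (metis One_nat_def Suc_leI less_le_trans mult_le_mono1 mult_1)
    then have "N * \<kappa> * l + j < N * \<kappa> * Suc l" by simp
    also have "\<dots> \<le> N * (m * \<kappa>)" using assms by (metis Suc_leI mult.assoc mult.commute mult_le_mono2)
    finally have "norm ((A ^^ (m * \<kappa>)) (\<lambda>z. z ^ (N * \<kappa> * l + j)) z) \<le>
      C * (c ^ ((N * \<kappa> * l + j) div N) * fact (N * \<kappa> * l + j))" using C(2) z by blast
    then have "height m \<kappa> ^ l * norm ((A ^^ (m * \<kappa>)) (\<lambda>z. z ^ (N * \<kappa> * l + j)) z) \<le>
      height m \<kappa> ^ l * (C * (c ^ ((N * \<kappa> * l + j) div N) * fact (N * \<kappa> * l + j)))"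
      by (intro mult_left_mono) (simp_all add: height_nonneg)
    then show "norm (of_real (height m \<kappa> ^ l) * (A ^^ (m * \<kappa>)) (\<lambda>z. z ^ (N * \<kappa> * l + j)) z) \<le> C * ?a \<kappa>"
      by (simp add: norm_mult norm_power height_nonneg mult_ac)
  qed
  moreover have "uniform_limit (cball 0 r) (\<lambda>\<kappa> (z::complex). C * ?a \<kappa>) (\<lambda>_. 0) sequentially"
    using a by (simp add: uniform_limit_iff tendsto_iff)
  ultimately show ?thesis by (rule uniform_limit_null_comparison)
qed

text \<open>Rescaling the argument of \<open>b\<close> by the degree \<open>L = N * (m * \<kappa>)\<close> compensates the growth
  \<open>(L + j)! / L! \<approx> L\<^sup>j\<close> that the iterates produce, so that the \<open>m\<close>-th power has a limit.\<close>

definition bump :: "nat \<Rightarrow> complex poly \<Rightarrow> nat \<Rightarrow> complex \<Rightarrow> complex" where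
  "bump m b \<kappa> z = of_real (height m \<kappa>) * z ^ (N * \<kappa>) * poly b (z / of_nat (N * (m * \<kappa>)))"

lemma bump_entire: "bump m b \<kappa> \<in> entire_functions"
proof -
  have "(\<lambda>z. poly b (1 / of_nat (N * (m * \<kappa>)) * z)) \<in> entire_functions"
    by (intro entire_poly_compose entire_mult entire_const entire_monomial[of 1, simplified])
  then have "(\<lambda>z. of_real (height m \<kappa>) * z ^ (N * \<kappa>) * poly b (1 / of_nat (N * (m * \<kappa>)) * z)) \<in> entire_functions"
    by (intro entire_mult entire_const entire_monomial)
  then show ?thesis by (simp add: bump_def[abs_def])
qed

lemma A_funpow_poly_bump:
  "(A ^^ q) (\<lambda>z. poly a z * bump m b \<kappa> z ^ l) =
    (\<lambda>z. \<Sum>i\<le>degree a. \<Sum>j\<le>degree (b ^ l).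
      coeff a i * coeff (b ^ l) j / of_nat (N * (m * \<kappa>)) ^ j *
        (of_real (height m \<kappa> ^ l) * (A ^^ q) (\<lambda>z. z ^ (N * \<kappa> * l + (i + j))) z))"
proof -
  let ?I = "{..degree a} \<times> {..degree (b ^ l)}"
  define d where "d = (\<lambda>(i, j). coeff a i * coeff (b ^ l) j / of_nat (N * (m * \<kappa>)) ^ j * of_real (height m \<kappa> ^ l))"
  have "poly a z * bump m b \<kappa> z ^ l = (\<Sum>x\<in>?I. d x * z ^ (N * \<kappa> * l + (fst x + snd x)))" for z
  proof -
    have "poly a z * bump m b \<kappa> z ^ l =
       (\<Sum>i\<le>degree a. coeff a i * z ^ i) *
       (of_real (height m \<kappa> ^ l) * z ^ (N * \<kappa> * l) * (\<Sum>j\<le>degree (b ^ l). coeff (b ^ l) j * (z / of_nat (N * (m * \<kappa>))) ^ j))"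
      unfolding poly_altdef[symmetric] by (simp add: bump_def power_mult_distrib power_mult)
    also have "\<dots> = (\<Sum>i\<le>degree a. \<Sum>j\<le>degree (b ^ l). d (i, j) * z ^ (N * \<kappa> * l + (i + j)))"
      by (subst sum_distrib_left, subst sum_product)
         (intro sum.cong refl, simp add: d_def power_add power_divide)
    finally show ?thesis by (simp add: sum.cartesian_product split_beta)
  qed
  then have "(A ^^ q) (\<lambda>z. poly a z * bump m b \<kappa> z ^ l) =
      (\<lambda>z. \<Sum>x\<in>?I. d x * (A ^^ q) (\<lambda>z. z ^ (N * \<kappa> * l + (fst x + snd x))) z)"
    using continuous_linear_operator_sum[OF A_funpow entire_monomial] by simp
  then show ?thesis by (simp add: sum.cartesian_product split_beta d_def mult.assoc)
qed

text \<open>The products below the top power are finite combinations of the monomials just treated. Their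
  coefficients stay bounded, because rescaling divides them by powers of \<open>N * (m * \<kappa>)\<close>.\<close>

lemma lower_power_limit:
  assumes "l < m"
  shows "uniform_limit (cball 0 r) (\<lambda>\<kappa>. (A ^^ (m * \<kappa>)) (\<lambda>z. poly a z * bump m b \<kappa> z ^ l)) (\<lambda>_. 0) sequentially"
proof -
  have "uniform_limit (cball 0 r) (\<lambda>\<kappa> z. coeff a i * coeff (b ^ l) j / of_nat (N * (m * \<kappa>)) ^ j *
        (of_real (height m \<kappa> ^ l) * (A ^^ (m * \<kappa>)) (\<lambda>z. z ^ (N * \<kappa> * l + (i + j))) z)) (\<lambda>_. 0) sequentially" for i j
  proof (rule uniform_limit_null_comparison)
    define D where "D = norm (coeff a i * coeff (b ^ l) j)"
    let ?g = "\<lambda>\<kappa> z. of_real (height m \<kappa> ^ l) * (A ^^ (m * \<kappa>)) (\<lambda>z. z ^ (N * \<kappa> * l + (i + j))) z"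
    have "uniform_limit (cball 0 r) (\<lambda>\<kappa> z. D * norm (?g \<kappa> z)) (\<lambda>z. D * norm (0::complex)) sequentially"
      by (intro bounded_linear.uniform_limit[OF bounded_linear_mult_right] uniform_limit_norm
          scaled_monomial_orbit_limit assms)
    then show "uniform_limit (cball 0 r) (\<lambda>\<kappa> z. D * norm (?g \<kappa> z)) (\<lambda>_. 0) sequentially" by simp
    \<comment> \<open>When \<open>\<kappa> = 0\<close> the quotient is a division by \<open>0\<^sup>j\<close>, which gives \<open>0\<close> or, for \<open>j = 0\<close>, the
        coefficient itself.\<close>
    have "norm (coeff a i * coeff (b ^ l) j / of_nat (N * (m * \<kappa>)) ^ j) \<le> D" for \<kappa>
    proof -
      have "D \<le> D * real L ^ j" if "0 < L" for L :: nat
      proof -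
        have "1 \<le> real L ^ j" using that by (simp add: one_le_power)
        then have "D * 1 \<le> D * real L ^ j" by (intro mult_left_mono) (auto simp: D_def)
        then show ?thesis by simp
      qed
      then show ?thesis
        by (cases "N * (m * \<kappa>) = 0"; cases j)
           (auto simp: D_def norm_divide norm_power norm_mult power_0_left divide_le_eq simp del: of_nat_mult mult_eq_0_iff)
    qed
    then show "\<forall>\<^sub>F \<kappa> in sequentially. \<forall>z\<in>cball 0 r.
      norm (coeff a i * coeff (b ^ l) j / of_nat (N * (m * \<kappa>)) ^ j * ?g \<kappa> z) \<le> D * norm (?g \<kappa> z)"
      by (intro always_eventually allI ballI) (simp only: norm_mult[of "_ / _"] mult_right_mono norm_ge_zero)
  qed
  then have "uniform_limit (cball 0 r) (\<lambda>\<kappa> z. \<Sum>i\<le>degree a. \<Sum>j\<le>degree (b ^ l).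
      coeff a i * coeff (b ^ l) j / of_nat (N * (m * \<kappa>)) ^ j *
        (of_real (height m \<kappa> ^ l) * (A ^^ (m * \<kappa>)) (\<lambda>z. z ^ (N * \<kappa> * l + (i + j))) z))
      (\<lambda>z. \<Sum>i\<le>degree a. \<Sum>j\<le>degree (b ^ l). 0) sequentially"
    by (intro uniform_limit_sum_family)
  then show ?thesis unfolding A_funpow_poly_bump by simp
qed

lemma top_power_limit:
  assumes m: "1 \<le> m"
  shows "uniform_limit (cball 0 r) (\<lambda>\<kappa>. (A ^^ (m * \<kappa>)) (\<lambda>z. bump m b \<kappa> z ^ m)) (borel_transform (b ^ m)) sequentially"
proof -
  define \<rho> where "\<rho> = (\<lambda>j L. fact (L + j) / (fact L * real L ^ j))"
  have "(A ^^ (m * \<kappa>)) (\<lambda>z. bump m b \<kappa> z ^ m) =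
     (\<lambda>z. \<Sum>j\<le>degree (b ^ m). of_real (\<rho> j (N * (m * \<kappa>))) * (coeff (b ^ m) j / fact j * z ^ j))" for \<kappa>
  proof -
    have "N * \<kappa> * m + j = N * (m * \<kappa>) + j" for j by (simp add: mult_ac)
    then have "(A ^^ (m * \<kappa>)) (\<lambda>z. z ^ (N * \<kappa> * m + j)) =
      (\<lambda>z. of_real (c ^ (m * \<kappa>) * fact (N * (m * \<kappa>) + j) / fact j) * z ^ j)" for j
      by (simp only: A_funpow_monomial_shift)
    moreover have "height m \<kappa> ^ m * (c ^ (m * \<kappa>) * fact (N * (m * \<kappa>) + j) / fact j) =
       fact (N * (m * \<kappa>) + j) / fact (N * (m * \<kappa>)) / fact j" for j
      unfolding height_power[OF m] using c_pos by simp
    ultimately have *: "of_real (height m \<kappa> ^ m) * (A ^^ (m * \<kappa>)) (\<lambda>z. z ^ (N * \<kappa> * m + j)) z =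
       of_real (fact (N * (m * \<kappa>) + j) / fact (N * (m * \<kappa>)) / fact j) * z ^ j" for j z
      by (metis (no_types, lifting) mult.assoc of_real_mult)
    show ?thesis
      using A_funpow_poly_bump[of "m * \<kappa>" 1 m b \<kappa> m]
      by (simp add: * \<rho>_def del: of_real_power of_nat_mult) (simp add: mult_ac)
  qed
  moreover have "uniform_limit (cball 0 r) (\<lambda>\<kappa> z. \<Sum>j\<le>degree (b ^ m). of_real (\<rho> j (N * (m * \<kappa>))) * (coeff (b ^ m) j / fact j * z ^ j))
     (\<lambda>z. \<Sum>j\<le>degree (b ^ m). of_real 1 * (coeff (b ^ m) j / fact j * z ^ j)) sequentially"
  proof (intro uniform_limit_sum_family)
    fix j
    have "filterlim (\<lambda>\<kappa>. N * (m * \<kappa>)) at_top sequentially"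
      using N_pos m by (intro filterlim_at_top_mono[OF filterlim_ident] always_eventually allI) simp
    then have "(\<lambda>\<kappa>. \<rho> j (N * (m * \<kappa>))) \<longlonglongrightarrow> 1"
      unfolding \<rho>_def by (rule filterlim_compose[OF fact_quotient_tendsto])
    then have "(\<lambda>\<kappa>. of_real (\<rho> j (N * (m * \<kappa>))) :: complex) \<longlonglongrightarrow> of_real 1"
      by (rule tendsto_of_real)
    then have 1: "uniform_limit (cball (0::complex) r) (\<lambda>\<kappa> z. of_real (\<rho> j (N * (m * \<kappa>))) :: complex) (\<lambda>z. of_real 1) sequentially"
      by (auto simp: uniform_limit_iff tendsto_iff)
    have 2: "bounded ((\<lambda>z::complex. of_real 1 :: complex) ` cball 0 r)"
      by (rule bounded_subset[of "{1}"]) auto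
    have "compact ((\<lambda>z. coeff (b ^ m) j / fact j * z ^ j) ` cball 0 r)"
      by (intro compact_continuous_image continuous_intros compact_cball)
    then have 3: "bounded ((\<lambda>z. coeff (b ^ m) j / fact j * z ^ j) ` cball 0 r)"
      by (rule compact_imp_bounded)
    show "uniform_limit (cball 0 r) (\<lambda>\<kappa> z. of_real (\<rho> j (N * (m * \<kappa>))) * (coeff (b ^ m) j / fact j * z ^ j))
       (\<lambda>z. of_real 1 * (coeff (b ^ m) j / fact j * z ^ j)) sequentially"
      by (rule uniform_lim_mult[OF 1 uniform_limit_const 2 3])
  qed
  ultimately show ?thesis by (simp add: borel_transform_def[abs_def])
qed

text \<open>The perturbation itself vanishes in the limit: on the disc of radius \<open>r\<close> it is at most a constant
  times \<open>((e r / L)\<^sup>N / c)\<^sup>\<kappa>\<close> with \<open>L = N * (m * \<kappa>)\<close>, and the base tends to zero.\<close>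

lemma bump_limit:
  assumes m: "1 \<le> m" and r: "0 \<le> r"
  shows "uniform_limit (cball 0 r) (bump m b) (\<lambda>_. 0) sequentially"
proof -
  have "compact (poly b ` cball 0 r)" by (intro compact_continuous_image continuous_intros compact_cball)
  then obtain M where M: "\<And>w. w \<in> cball 0 r \<Longrightarrow> norm (poly b w) \<le> M"
    using compact_imp_bounded[of "poly b ` cball 0 r"] unfolding bounded_iff by blast
  define q where "q = (\<lambda>\<kappa>. (exp 1 * r / real (N * (m * \<kappa>))) ^ N / c)"
  have "filterlim (\<lambda>\<kappa>. N * (m * \<kappa>)) at_top sequentially"
    using N_pos m by (intro filterlim_at_top_mono[OF filterlim_ident] always_eventually allI) simp
  then have "(\<lambda>\<kappa>. exp 1 * r / real (N * (m * \<kappa>))) \<longlonglongrightarrow> 0"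
    by (rule filterlim_compose[OF lim_const_over_n])
  then have "q \<longlonglongrightarrow> 0 ^ N / c" unfolding q_def by (intro tendsto_intros) (use c_pos in auto)
  then have "q \<longlonglongrightarrow> 0" using N_pos by (simp add: power_0_left)
  then have small: "\<forall>\<^sub>F \<kappa> in sequentially. q \<kappa> < 1/2" by (rule order_tendstoD) simp
  have M0: "0 \<le> M" using M[of 0] r norm_ge_zero[of "poly b 0"] by (simp del: norm_ge_zero)
  have "\<forall>\<^sub>F \<kappa> in sequentially. \<forall>z\<in>cball 0 r. norm (bump m b \<kappa> z) \<le> (1/2) ^ \<kappa> * M"
    using small eventually_ge_at_top[of 1]
  proof eventually_elim
    case (elim \<kappa>)
    define L where "L = N * (m * \<kappa>)"
    have "0 < L" using elim m N_pos by (simp add: L_def)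
    then have L: "1 \<le> real L" by simp
    have "height m \<kappa> * r ^ (N * \<kappa>) = (height m \<kappa> * c ^ \<kappa>) * r ^ (N * \<kappa>) / c ^ \<kappa>" using c_pos by simp
    also have "\<dots> \<le> (exp 1 / real L) ^ (N * \<kappa>) * r ^ (N * \<kappa>) / c ^ \<kappa>"
      using height_le[OF m elim(2)] r c_pos by (intro divide_right_mono mult_right_mono) (auto simp: L_def)
    also have "\<dots> = q \<kappa> ^ \<kappa>" by (simp add: q_def L_def power_mult power_divide power_mult_distrib)
    also have "\<dots> \<le> (1/2) ^ \<kappa>" using elim c_pos r by (intro power_mono) (auto simp: q_def)
    finally have *: "height m \<kappa> * r ^ (N * \<kappa>) \<le> (1/2) ^ \<kappa>" .
    show ?case
    proof
      fix z :: complex assume z: "z \<in> cball 0 r"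
      have "norm z / real L \<le> norm z / 1" using L by (intro divide_left_mono) auto
      then have "norm (z / of_nat L) \<le> norm z" by (simp add: norm_divide)
      then have "z / of_nat L \<in> cball 0 r" using z by simp
      then have "norm (poly b (z / of_nat L)) \<le> M" by (rule M)
      moreover have "height m \<kappa> * norm z ^ (N * \<kappa>) \<le> (1/2) ^ \<kappa>"
        using z height_nonneg by (intro order_trans[OF mult_left_mono *] power_mono) auto
      ultimately have "(height m \<kappa> * norm z ^ (N * \<kappa>)) * norm (poly b (z / of_nat L)) \<le> (1/2) ^ \<kappa> * M"
        using height_nonneg by (intro mult_mono) auto
      then show "norm (bump m b \<kappa> z) \<le> (1/2) ^ \<kappa> * M"
        by (simp add: bump_def norm_mult norm_power height_nonneg L_def)
    qed
  qed
  moreover have "(\<lambda>\<kappa>. (1/2) ^ \<kappa> * M) \<longlonglongrightarrow> 0 * M"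
    by (intro tendsto_mult tendsto_const LIMSEQ_power_zero) simp
  then have "uniform_limit (cball (0::complex) r) (\<lambda>\<kappa> z. (1/2) ^ \<kappa> * M) (\<lambda>_. 0) sequentially"
    by (simp add: uniform_limit_iff tendsto_iff)
  ultimately show ?thesis by (rule uniform_limit_null_comparison)
qed

text \<open>Expanding by the binomial theorem, every term containing fewer than \<open>m\<close> factors of the perturbation
  dies out; a term with \<open>m\<close> factors occurs only for \<open>i = m\<close>, and there it is the pure power.\<close>

lemma binomial_power_limit:
  assumes i: "1 \<le> i" "i \<le> m"
  shows "uniform_limit (cball 0 r) (\<lambda>\<kappa>. (A ^^ (m * \<kappa>)) (\<lambda>z. (bump m b \<kappa> z + poly p z) ^ i))
    (if i = m then borel_transform (b ^ m) else (\<lambda>z. 0)) sequentially"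
proof -
  define h where "h = (\<lambda>l. if l = m then borel_transform (b ^ m) else (\<lambda>z. 0))"
  have "(A ^^ (m * \<kappa>)) (\<lambda>z. (bump m b \<kappa> z + poly p z) ^ i) =
    (\<lambda>z. \<Sum>l\<le>i. of_nat (i choose l) * (A ^^ (m * \<kappa>)) (\<lambda>z. poly (p ^ (i - l)) z * bump m b \<kappa> z ^ l) z)" for \<kappa>
  proof -
    have "(\<lambda>z. (bump m b \<kappa> z + poly p z) ^ i) =
      (\<lambda>z. \<Sum>l\<le>i. of_nat (i choose l) * (poly (p ^ (i - l)) z * bump m b \<kappa> z ^ l))"
      by (simp add: binomial_ring mult_ac)
    then show ?thesis
      by (simp only:) (intro continuous_linear_operator_sum[OF A_funpow] entire_mult entire_poly
          entire_power bump_entire)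
  qed
  moreover have "uniform_limit (cball 0 r) (\<lambda>\<kappa> z. \<Sum>l\<le>i. of_nat (i choose l) *
      (A ^^ (m * \<kappa>)) (\<lambda>z. poly (p ^ (i - l)) z * bump m b \<kappa> z ^ l) z)
      (\<lambda>z. \<Sum>l\<le>i. of_nat (i choose l) * h l z) sequentially"
  proof (intro uniform_limit_sum_family uniform_limit_cmult)
    fix l assume "l \<in> {..i}"
    show "uniform_limit (cball 0 r) (\<lambda>\<kappa>. (A ^^ (m * \<kappa>)) (\<lambda>z. poly (p ^ (i - l)) z * bump m b \<kappa> z ^ l)) (h l) sequentially"
    proof (cases "l = m")
      case True
      with \<open>l \<in> {..i}\<close> i have "i = l" "1 \<le> m" by auto
      then show ?thesis using top_power_limit[of m b r] True by (simp add: h_def)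
    next
      case False
      with \<open>l \<in> {..i}\<close> i have "l < m" by auto
      from lower_power_limit[OF this] show ?thesis using False by (simp add: h_def del: poly_power)
    qed
  qed
  moreover have "(\<lambda>z. \<Sum>l\<le>i. of_nat (i choose l) * h l z) = (if i = m then borel_transform (b ^ m) else (\<lambda>z. 0))"
  proof
    fix z
    have "(\<Sum>l\<le>i. of_nat (i choose l) * h l z) = (\<Sum>l\<le>i. if l = m then of_nat (i choose m) * borel_transform (b ^ m) z else 0)"
      by (intro sum.cong) (auto simp: h_def)
    then show "(\<Sum>l\<le>i. of_nat (i choose l) * h l z) = (if i = m then borel_transform (b ^ m) else (\<lambda>z. 0)) z"
      using i by auto
  qed
  ultimately show ?thesis by simp
qed

theorem A_supports_hypercyclic_algebra: "supports_hypercyclic_algebra A"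
proof (rule hypercyclic_algebra_criterion[OF A_operator])
  fix m :: nat and f g :: "complex \<Rightarrow> complex" and r e :: real
  assume m: "1 \<le> m" and f: "f \<in> entire_functions" and g: "g \<in> entire_functions" and e: "0 < e"
  define R where "R = max r 0"
  obtain p where p: "poly p \<in> compact_nhd f (cball 0 R) (e/2)"
    using polynomials_dense[OF f, of "e/2" R] e by auto
  obtain b where b: "borel_transform (b ^ m) \<in> compact_nhd g (cball 0 R) (e/2)"
    using borel_transforms_of_powers_dense[OF m g, of "e/2" R] e by auto
  define target where "target = (\<lambda>g i. if i = m then g else (\<lambda>z::complex. 0::complex))"
  have "\<forall>\<^sub>F \<kappa> in sequentially. \<forall>z\<in>cball 0 R. dist (bump m b \<kappa> z) 0 < e/2"
    by (rule uniform_limitD[OF bump_limit]) (use m e in \<open>auto simp: R_def\<close>)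
  moreover have "\<forall>\<^sub>F \<kappa> in sequentially. \<forall>i\<in>{1..m}. \<forall>z\<in>cball 0 R.
     dist ((A ^^ (m * \<kappa>)) (\<lambda>z. (bump m b \<kappa> z + poly p z) ^ i) z) (target (borel_transform (b ^ m)) i z) < e/2"
    unfolding target_def
    by (intro eventually_ball_finite ballI uniform_limitD[OF binomial_power_limit]) (use e in auto)
  ultimately have "\<forall>\<^sub>F \<kappa> in sequentially. (\<forall>z\<in>cball 0 R. dist (bump m b \<kappa> z) 0 < e/2) \<and>
     (\<forall>i\<in>{1..m}. \<forall>z\<in>cball 0 R.
     dist ((A ^^ (m * \<kappa>)) (\<lambda>z. (bump m b \<kappa> z + poly p z) ^ i) z) (target (borel_transform (b ^ m)) i z) < e/2)"
    by (rule eventually_conj)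
  then obtain \<kappa> where \<kappa>1: "\<forall>z\<in>cball 0 R. dist (bump m b \<kappa> z) 0 < e/2"
    and \<kappa>2: "\<forall>i\<in>{1..m}. \<forall>z\<in>cball 0 R.
      dist ((A ^^ (m * \<kappa>)) (\<lambda>z. (bump m b \<kappa> z + poly p z) ^ i) z) (target (borel_transform (b ^ m)) i z) < e/2"
    using eventually_happens'[OF sequentially_bot] by blast
  define u where "u = (\<lambda>z. bump m b \<kappa> z + poly p z)"
  have sub: "cball 0 r \<subseteq> cball (0::complex) R" by (auto simp: R_def)
  have uE: "u \<in> entire_functions" unfolding u_def by (intro entire_add bump_entire entire_poly)
  have "dist (u z) (f z) < e" if "z \<in> cball 0 R" for z
  proof -
    have "dist (poly p z) (f z) < e/2" using p that by (simp add: compact_nhd_def)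
    moreover have "dist (u z) (poly p z) < e/2" using \<kappa>1 that by (simp add: u_def dist_norm)
    ultimately show ?thesis using dist_triangle[of "u z" "f z" "poly p z"] by simp
  qed
  then have "u \<in> compact_nhd f (cball 0 r) e" using uE sub by (auto simp: compact_nhd_def)
  moreover have "(A ^^ (m * \<kappa>)) (\<lambda>z. u z ^ i) \<in> compact_nhd (if i = m then g else (\<lambda>z. 0)) (cball 0 r) e"
    if i: "i \<in> {1..m}" for i
  proof -
    have "dist ((A ^^ (m * \<kappa>)) (\<lambda>z. u z ^ i) z) (target g i z) < e" if z: "z \<in> cball 0 R" for z
    proof -
      have "dist (target (borel_transform (b ^ m)) i z) (target g i z) < e/2"
        using b z e by (auto simp: target_def compact_nhd_def)
      moreover have "dist ((A ^^ (m * \<kappa>)) (\<lambda>z. u z ^ i) z) (target (borel_transform (b ^ m)) i z) < e/2"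
        using \<kappa>2 i z by (simp add: u_def)
      ultimately show ?thesis
        using dist_triangle[of "(A ^^ (m * \<kappa>)) (\<lambda>z. u z ^ i) z" "target g i z" "target (borel_transform (b ^ m)) i z"]
        by simp
    qed
    then have "(A ^^ (m * \<kappa>)) (\<lambda>z. u z ^ i) \<in> compact_nhd (target g i) (cball 0 r) e"
      using sub A_funpowD(1)[OF entire_power[OF uE]] by (auto simp: compact_nhd_def)
    then show ?thesis by (simp add: target_def)
  qed
  ultimately show "\<exists>u\<in>compact_nhd f (cball 0 r) e. \<exists>q. \<forall>i\<in>{1..m}.
      (A ^^ q) (\<lambda>z. u z ^ i) \<in> compact_nhd (if i = m then g else (\<lambda>z. 0)) (cball 0 r) e"
    by blast
qed

end

theorem theorem5p1:
  fixes B :: "(complex \<Rightarrow> complex) \<Rightarrow> (complex \<Rightarrow> complex)" and n :: nat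
  assumes "continuous_linear_operator B"
    and "\<And>f. f \<in> entire_functions \<Longrightarrow>
           B f = taylor_truncation n (B (taylor_truncation n f))"
    and "\<And>j::nat. limitin entire_topology (\<lambda>m. (B ^^ m) (\<lambda>z. z ^ j)) (\<lambda>z. 0) sequentially"
  shows "\<forall>\<delta>::real. 0 < \<delta> \<and> \<delta> < 1 \<longrightarrow>
           supports_hypercyclic_algebra
             (\<lambda>f z. B f z + of_real \<delta> * scaled_deriv (n + 1) f z)"
proof (intro allI impI)
  fix \<delta> :: real assume "0 < \<delta> \<and> \<delta> < 1"
  then interpret truncated_plus_shift B n \<delta>
    by unfold_locales (use assms in auto)
  show "supports_hypercyclic_algebra (\<lambda>f z. B f z + of_real \<delta> * scaled_deriv (n + 1) f z)"
    using A_supports_hypercyclic_algebra by (simp add: A_def N_def)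
qed

end
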